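(* Let $B$ be a standard one-dimensional Brownian motion with $B(0)=0$, let $\mu$ be a function as in the context, and let $L$ be the associated local time process of $X(t)=B(t)+L(t)+\int_0^t\mu(L(s))\,ds$. Let $\phi(b)=\inf\{t: L(t)=b\}$ (with $\inf\emptyset=\infty$) and $\tau_\infty=\inf\{s:\phi(s)=\infty\}$ (equivalently $\tau_\infty=\sup\{L(t):t\ge0\}$). Then for every $\tau\ge 0$, $$P\{\tau_\infty>\tau\}=\exp\Big(-2\int_0^\tau (\mu(s)\vee 0)\,ds\Big).$$
   Context: $\mu:[0,\infty)\to\mathbb{R}$ is continuous and monotone, with $\sup_{a<b<l}\frac{|\mu(b)-\mu(a)|}{b-a}<\infty$ for every $l$, and, if $\mu(l)\to-\infty$ as $l\to\infty$, with $\sum_n(|\mu(n)|\vee1)^{-1}=\infty$. The process $L$ is, pathwise, the unique continuous function on $[0,\infty)$ such that: (1) $X(t)=B(t)+L(t)+\int_0^t\mu(L(s))\,ds\ge 0$; (2) $L(0)=0$ and $L$ is nondecreasing; (3) $\int_0^\infty 1_{\{X(s)>0\}}\,dL(s)=0$. Here $a\vee b=\max(a,b)$. *)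

theory Defs
  imports "HOL-Probability.Probability"
begin

text \<open>
  Every path is required to start at 0 and to be continuous, because the reflected process below is
  constructed from it path by path. Only times \<open>t \<ge> 0\<close> matter.
\<close>

locale brownian_motion = prob_space M for M :: "'a measure" +
  fixes B :: "real \<Rightarrow> 'a \<Rightarrow> real"
  assumes measurable_at: "\<And>t. 0 \<le> t \<Longrightarrow> B t \<in> borel_measurable M"
    and start: "\<And>\<omega>. \<omega> \<in> space M \<Longrightarrow> B 0 \<omega> = 0"
    and continuous_paths: "\<And>\<omega>. \<omega> \<in> space M \<Longrightarrow> continuous_on {0..} (\<lambda>t. B t \<omega>)"
    and normal_increments: "\<And>s t. 0 \<le> s \<Longrightarrow> s < t \<Longrightarrow>
      distributed M lborel (\<lambda>\<omega>. B t \<omega> - B s \<omega>) (normal_density 0 (sqrt (t - s)))"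
    and indep_increments: "\<And>(ts :: nat \<Rightarrow> real) n. 0 \<le> ts 0 \<Longrightarrow> mono_on {..n} ts \<Longrightarrow>
      indep_vars (\<lambda>_. borel) (\<lambda>i \<omega>. B (ts (Suc i)) \<omega> - B (ts i) \<omega>) {..<n}"

definition admissible_drift :: "(real \<Rightarrow> real) \<Rightarrow> bool" where
  "admissible_drift \<mu> \<longleftrightarrow>
     continuous_on {0..} \<mu> \<and>
     (mono_on {0..} \<mu> \<or> antimono_on {0..} \<mu>) \<and>
     (\<forall>l. bdd_above {\<bar>\<mu> b - \<mu> a\<bar> / (b - a) | a b. 0 \<le> a \<and> a < b \<and> b < l}) \<and>
     (filterlim \<mu> at_bot at_top \<longrightarrow> \<not> summable (\<lambda>n::nat. inverse (max \<bar>\<mu> (real n)\<bar> 1)))"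

definition reflected_path :: "(real \<Rightarrow> real) \<Rightarrow> (real \<Rightarrow> real) \<Rightarrow> (real \<Rightarrow> real) \<Rightarrow> real \<Rightarrow> real" where
  "reflected_path \<mu> f L t = f t + L t + (LBINT s:{0..t}. \<mu> (L s))"

text \<open>
  The Stieltjes measure \<open>dL\<close> of a continuous nondecreasing \<open>L\<close> on \<open>[0, \<infinity>)\<close> is obtained from
  \<^const>\<open>interval_measure\<close> after extending \<open>L\<close> to the real line by its value at 0.
\<close>

definition is_local_time :: "(real \<Rightarrow> real) \<Rightarrow> (real \<Rightarrow> real) \<Rightarrow> (real \<Rightarrow> real) \<Rightarrow> bool" where
  "is_local_time \<mu> f L \<longleftrightarrow>
     continuous_on {0..} L \<and>
     (\<forall>t\<ge>0. 0 \<le> reflected_path \<mu> f L t) \<and>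
     L 0 = 0 \<and> mono_on {0..} L \<and>
     (\<integral>\<^sup>+ s\<in>{0..}. indicator {s. 0 < reflected_path \<mu> f L s} s
        \<partial>interval_measure (\<lambda>s. L (max s 0))) = 0"

text \<open>The infima are taken in \<^typ>\<open>ereal\<close>, so that the infimum of the empty set is \<open>\<infinity>\<close>.\<close>

definition hitting_time :: "(real \<Rightarrow> real) \<Rightarrow> real \<Rightarrow> ereal" where
  "hitting_time L b = Inf (ereal ` {t. 0 \<le> t \<and> L t = b})"

definition tau_inf :: "(real \<Rightarrow> real) \<Rightarrow> ereal" where
  "tau_inf L = Inf (ereal ` {s. 0 \<le> s \<and> hitting_time L s = \<infinity>})"

end

theory Submission
  imports Defs
begin

text \<open>
  Let \<open>X\<close> be the reflected process and \<open>g \<ge> 0\<close> a function on the local time axis. The process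
  \<open>W\<^sub>t = exp (2 \<integral>\<^sub>0\<^bsup>L t\<^esup> g - 2 g(L t) X t - 2 \<integral>\<^sub>0\<^sup>t g(L s) (g(L s) - \<mu>(L s)) ds)\<close>
  is the exponential martingale of \<open>- 2 \<integral> g(L) dB\<close>: substitute \<open>dB = dX - dL - \<mu>(L) dt\<close> and integrate
  \<open>g(L) dX\<close> by parts; no term \<open>X dg(L)\<close> remains, because \<open>L\<close> grows only where \<open>X = 0\<close>. Hence
  \<open>W\<close> has expectation 1 at every time. Two choices of \<open>g\<close> turn this into the two halves of the formula.

  For the upper bound, \<open>g\<close> is the positive part of \<open>\<mu>\<close> up to the level \<open>\<tau>\<close> and decreases to 0 before a
  level \<open>c > \<tau>\<close>. The time integral then only increases \<open>W\<close>, and the term with \<open>X\<close> has disappeared once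
  the level \<open>c\<close> is reached, so \<open>W \<ge> exp (2 \<integral>\<^sub>0\<^sup>\<tau> max \<mu> 0)\<close> on that event, whose probability is
  therefore at most the reciprocal (\<open>prob_reaching_le_exp\<close>). For the lower bound, \<open>g\<close> exceeds the
  positive part of \<open>\<mu>\<close> by \<open>\<epsilon>\<close> up to the level \<open>c\<close>, and both \<open>\<mu>\<close> and \<open>g\<close> are brought down to 0 above it;
  changing \<open>\<mu>\<close> there does not affect whether \<open>c\<close> is reached. Now \<open>W\<close> is bounded by
  \<open>exp (2 \<integral> g)\<close>, and by \<open>exp (2 \<integral> g - 2 \<epsilon>\<^sup>2 T)\<close> if \<open>c\<close> has not been reached by time \<open>T\<close>, so as
  \<open>T\<close> grows the expectation 1 has to come from the paths that reach \<open>c\<close> (\<open>one_le_exp_prob_reaching\<close>).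

  Stochastic integrals are avoided by discretizing time. In the Euler scheme for \<open>(L, X)\<close>
  the new value of \<open>X\<close> is exactly 0 in every step in which \<open>L\<close> increases, so the summation by parts is
  still an identity (\<open>euler_summation_by_parts\<close>), and the discrete weight, a product of exponentials
  of independent Gaussian increments with coefficients that depend only on the past, has expectation exactly 1 and second moments bounded uniformly
  in the mesh (\<open>euler_weight_moments\<close>). Path by path the scheme converges to \<open>L\<close> (\<open>euler_converges\<close>).
  The same convergence shows that the events in question are measurable, which is not given, as
  \<open>L\<close> is specified for each path separately.
\<close>

section \<open>Lipschitz functions and Riemann sums\<close>

lemma lipschitz_imp_continuous_on:
  fixes g :: "real \<Rightarrow> real"
  assumes "\<And>x y. \<bar>g x - g y\<bar> \<le> K * \<bar>x - y\<bar>"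
  shows "continuous_on S g"
proof (rule lipschitz_on_continuous_on[of K])
  show "K-lipschitz_on S g"
    using assms[of 0 1] assms by (intro lipschitz_onI) (auto simp: dist_real_def)
qed

lemma lipschitz_imp_integrable_on:
  fixes g :: "real \<Rightarrow> real"
  assumes "\<And>x y. \<bar>g x - g y\<bar> \<le> K * \<bar>x - y\<bar>"
  shows "g integrable_on {a..b}"
  by (rule integrable_continuous_real, rule lipschitz_imp_continuous_on, rule assms)

lemma lipschitz_imp_borel_measurable:
  fixes g :: "real \<Rightarrow> real"
  assumes "\<And>x y. \<bar>g x - g y\<bar> \<le> K * \<bar>x - y\<bar>"
  shows "g \<in> borel_measurable borel"
  by (rule borel_measurable_continuous_onI, rule lipschitz_imp_continuous_on, rule assms)

lemma left_riemann_sum_error: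
  fixes g :: "real \<Rightarrow> real" and l :: "nat \<Rightarrow> real"
  assumes lip: "\<And>x y. \<bar>g x - g y\<bar> \<le> K * \<bar>x - y\<bar>"
    and inc: "\<And>i. i < n \<Longrightarrow> l i \<le> l (Suc i)"
    and mesh: "\<And>i. i < n \<Longrightarrow> l (Suc i) - l i \<le> h"
  shows "\<bar>(\<Sum>i<n. g (l i) * (l (Suc i) - l i)) - integral {l 0..l n} g\<bar> \<le> K * h * (l n - l 0)"
  using inc mesh
proof (induction n)
  case 0
  then show ?case by simp
next
  case (Suc n)
  have K: "0 \<le> K" using lip[of 0 1] by simp
  have cont: "continuous_on S g" for S
    by (rule lipschitz_imp_continuous_on[OF lip])
  have int: "g integrable_on {a..b}" for a b
    by (rule lipschitz_imp_integrable_on[OF lip])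
  have ln: "l 0 \<le> l n"
  proof -
    have "i \<le> n \<Longrightarrow> l 0 \<le> l i" for i
    proof (induction i)
      case (Suc j)
      then show ?case using \<open>\<And>i. i < Suc n \<Longrightarrow> l i \<le> l (Suc i)\<close>[of j] by simp
    qed simp
    then show ?thesis by simp
  qed
  have step: "l n \<le> l (Suc n)" "l (Suc n) - l n \<le> h" using Suc.prems by auto
  have "integral {l 0..l (Suc n)} g = integral {l 0..l n} g + integral {l n..l (Suc n)} g"
    using Henstock_Kurzweil_Integration.integral_combine[OF ln step(1) int] by simp
  moreover have "\<bar>g (l n) * (l (Suc n) - l n) - integral {l n..l (Suc n)} g\<bar> \<le> K * h * (l (Suc n) - l n)"
  proof -
    have "g (l n) * (l (Suc n) - l n) - integral {l n..l (Suc n)} g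
        = integral {l n..l (Suc n)} (\<lambda>x. g (l n) - g x)"
      using step int by (subst Henstock_Kurzweil_Integration.integral_diff) auto
    moreover have "norm (integral {l n..l (Suc n)} (\<lambda>x. g (l n) - g x)) \<le> K * h * (l (Suc n) - l n)"
    proof (rule integral_bound[OF step(1)])
      show "continuous_on {l n..l (Suc n)} (\<lambda>x. g (l n) - g x)"
        by (intro continuous_intros cont)
      show "norm (g (l n) - g x) \<le> K * h" if "x \<in> {l n..l (Suc n)}" for x
      proof -
        have "norm (g (l n) - g x) \<le> K * \<bar>l n - x\<bar>" using lip by simp
        also have "\<dots> \<le> K * h" using that step K by (intro mult_left_mono) auto
        finally show ?thesis .
      qed
    qed
    ultimately show ?thesis by simp
  qed
  moreover have "\<bar>(\<Sum>i<n. g (l i) * (l (Suc i) - l i)) - integral {l 0..l n} g\<bar> \<le> K * h * (l n - l 0)"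
    using Suc by simp
  ultimately show ?case by (simp add: algebra_simps)
qed

text \<open>
  Used with \<open>x\<close> a random local time: beyond the level \<open>b\<close> the accumulated exponent no longer depends on it.
\<close>

lemma integral_vanishing_tail:
  fixes g :: "real \<Rightarrow> real"
  assumes int: "g integrable_on {0..x}" and b: "0 \<le> b" "b \<le> x" and van: "\<And>y. b \<le> y \<Longrightarrow> g y = 0"
  shows "integral {0..x} g = integral {0..b} g"
proof -
  have "integral {b..x} g = integral {b..x} (\<lambda>_. 0)"
    by (rule integral_cong) (use van in auto)
  moreover have "integral {0..b} g + integral {b..x} g = integral {0..x} g"
    by (rule Henstock_Kurzweil_Integration.integral_combine[OF b int])
  ultimately show ?thesis by simp
qed

text \<open>
  Multiplication by this cutoff switches a function off between the levels \<open>a\<close> and \<open>b\<close> without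
  destroying Lipschitz continuity, which a sharp indicator would.
\<close>

definition ramp :: "real \<Rightarrow> real \<Rightarrow> real \<Rightarrow> real" where
  "ramp a b x = max 0 (min 1 ((b - x) / (b - a)))"

lemma ramp_range: "0 \<le> ramp a b x" "ramp a b x \<le> 1"
  by (auto simp: ramp_def)

lemma ramp_eq:
  assumes "a < b"
  shows "x \<le> a \<Longrightarrow> ramp a b x = 1" "b \<le> x \<Longrightarrow> ramp a b x = 0"
proof -
  assume "x \<le> a"
  then have "1 \<le> (b - x) / (b - a)" using assms by simp
  then show "ramp a b x = 1" by (simp add: ramp_def)
next
  assume "b \<le> x"
  then have "(b - x) / (b - a) \<le> 0" using assms by (intro divide_nonpos_pos) auto
  then show "ramp a b x = 0" by (simp add: ramp_def)
qed

lemma ramp_lipschitz: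
  assumes "a < b"
  shows "\<bar>ramp a b x - ramp a b y\<bar> \<le> 1 / (b - a) * \<bar>x - y\<bar>"
proof -
  have "\<bar>ramp a b x - ramp a b y\<bar> \<le> \<bar>(b - x) / (b - a) - (b - y) / (b - a)\<bar>"
    unfolding ramp_def by (auto simp: max_def min_def)
  also have "\<dots> = 1 / (b - a) * \<bar>x - y\<bar>"
    using assms by (simp add: diff_divide_distrib[symmetric] abs_minus_commute)
  finally show ?thesis .
qed

lemma lipschitz_mult_bounded:
  fixes p q :: "real \<Rightarrow> real"
  assumes p: "\<bar>p x - p y\<bar> \<le> K * \<bar>x - y\<bar>" "\<bar>p y\<bar> \<le> C"
    and q: "\<bar>q x - q y\<bar> \<le> K' * \<bar>x - y\<bar>" "\<bar>q x\<bar> \<le> 1"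
  shows "\<bar>p x * q x - p y * q y\<bar> \<le> (K + C * K') * \<bar>x - y\<bar>"
proof -
  have "p x * q x - p y * q y = (p x - p y) * q x + p y * (q x - q y)"
    by (simp add: algebra_simps)
  then have "\<bar>p x * q x - p y * q y\<bar> \<le> \<bar>p x - p y\<bar> * \<bar>q x\<bar> + \<bar>p y\<bar> * \<bar>q x - q y\<bar>"
    by (metis abs_mult abs_triangle_ineq)
  also have "\<dots> \<le> K * \<bar>x - y\<bar> * 1 + C * (K' * \<bar>x - y\<bar>)"
    using p q by (intro add_mono mult_mono) (auto intro: order_trans[OF abs_ge_zero])
  finally show ?thesis by (simp add: algebra_simps)
qed

section \<open>An Euler scheme for the reflected path\<close>

text \<open>
  A state is the accumulated drift together with the local time; \<open>m\<close> is the drift as a function of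
  local time, \<open>d\<close> the mesh and \<open>w i\<close> the driving path at time \<open>d * i\<close>. The maximum is the running
  maximum of Skorohod's reflection map.
\<close>

primrec euler_state :: "(real \<Rightarrow> real) \<Rightarrow> real \<Rightarrow> (nat \<Rightarrow> real) \<Rightarrow> nat \<Rightarrow> real \<times> real" where
  "euler_state m d w 0 = (0, 0)"
| "euler_state m d w (Suc i) =
     (let A' = fst (euler_state m d w i) + d * m (snd (euler_state m d w i))
      in (A', max (snd (euler_state m d w i)) (- (w (Suc i) + A'))))"

definition euler_drift :: "(real \<Rightarrow> real) \<Rightarrow> real \<Rightarrow> (nat \<Rightarrow> real) \<Rightarrow> nat \<Rightarrow> real" where
  "euler_drift m d w i = fst (euler_state m d w i)"

definition euler_local :: "(real \<Rightarrow> real) \<Rightarrow> real \<Rightarrow> (nat \<Rightarrow> real) \<Rightarrow> nat \<Rightarrow> real" where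
  "euler_local m d w i = snd (euler_state m d w i)"

lemma euler_0 [simp]: "euler_drift m d w 0 = 0" "euler_local m d w 0 = 0"
  by (simp_all add: euler_drift_def euler_local_def)

lemma euler_drift_Suc:
  "euler_drift m d w (Suc i) = euler_drift m d w i + d * m (euler_local m d w i)"
  by (simp add: euler_drift_def euler_local_def Let_def)

lemma euler_local_Suc:
  "euler_local m d w (Suc i) =
     max (euler_local m d w i) (- (w (Suc i) + euler_drift m d w (Suc i)))"
  by (simp add: euler_drift_def euler_local_def Let_def)

lemma euler_local_mono: "i \<le> j \<Longrightarrow> euler_local m d w i \<le> euler_local m d w j"
  by (rule lift_Suc_mono_le[of "euler_local m d w"]) (simp_all add: euler_local_Suc)

lemma euler_local_nonneg: "0 \<le> euler_local m d w i"
  using euler_local_mono[of 0 i m d w] by simp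

lemma euler_reflected_nonneg:
  assumes "w 0 = 0"
  shows "0 \<le> w i + euler_drift m d w i + euler_local m d w i"
  by (cases i) (auto simp: assms euler_local_Suc)

lemma euler_drift_bound:
  assumes "\<And>x. \<bar>m x\<bar> \<le> C" "0 \<le> d"
  shows "\<bar>euler_drift m d w i\<bar> \<le> C * (d * real i)"
proof (induction i)
  case (Suc i)
  have "\<bar>d * m (euler_local m d w i)\<bar> \<le> d * C"
    using assms by (simp add: abs_mult mult_left_mono)
  then show ?case using Suc by (auto simp: euler_drift_Suc algebra_simps)
qed simp

lemma euler_local_bound:
  assumes m: "\<And>x. \<bar>m x\<bar> \<le> C" and d: "0 \<le> d"
    and w: "\<And>j. j \<le> i \<Longrightarrow> \<bar>w j\<bar> \<le> F" and F: "0 \<le> F"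
  shows "euler_local m d w i \<le> F + C * (d * real i)"
  using w
proof (induction i)
  case 0
  then show ?case using F by simp
next
  case (Suc i)
  have C: "0 \<le> C" using m[of 0] by linarith
  have "euler_local m d w i \<le> F + C * (d * real i)" using Suc by simp
  also have "\<dots> \<le> F + C * (d * real (Suc i))"
    using C d by (intro add_left_mono mult_left_mono) auto
  finally have 1: "euler_local m d w i \<le> F + C * (d * real (Suc i))" .
  have "\<bar>euler_drift m d w (Suc i)\<bar> \<le> C * (d * real (Suc i))"
    by (rule euler_drift_bound[OF m d])
  moreover have "\<bar>w (Suc i)\<bar> \<le> F" using Suc.prems by simp
  ultimately have "- (w (Suc i) + euler_drift m d w (Suc i)) \<le> F + C * (d * real (Suc i))"
    by linarith
  with 1 show ?case by (simp add: euler_local_Suc)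
qed

text \<open>
  The scheme cannot gain more local time in one step than the driving path and the drift move
  downwards, since the reflected path was nonnegative before the step.
\<close>

lemma euler_local_step:
  assumes m: "\<And>x. \<bar>m x\<bar> \<le> C" and d: "0 \<le> d" and w: "w 0 = 0" "\<bar>w (Suc i) - w i\<bar> \<le> e"
  shows "euler_local m d w (Suc i) - euler_local m d w i \<le> e + d * C"
proof -
  have "\<bar>d * m (euler_local m d w i)\<bar> \<le> d * C"
    using m d by (simp add: abs_mult mult_left_mono)
  moreover have "0 \<le> w i + euler_drift m d w i + euler_local m d w i"
    by (rule euler_reflected_nonneg[where w = w, OF w(1)])
  moreover have "0 \<le> e + d * C" 
    using w(2) calculation(1) by linarith
  ultimately show ?thesis using w(2) unfolding euler_local_Suc euler_drift_Suc by linarith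
qed

text \<open>
  Discrete counterpart of \<open>\<integral> g(L) dB = g(L) X - \<integral> g(L) dL - \<integral> g(L) m(L) dt\<close>. It carries no error
  term because in each step the local time stays put or the new reflected position is 0.
\<close>

lemma euler_summation_by_parts:
  assumes "w 0 = 0"
  shows "(\<Sum>i<n. g (euler_local m d w i) * (w (Suc i) - w i)) =
    g (euler_local m d w n) * (w n + euler_drift m d w n + euler_local m d w n)
    - (\<Sum>i<n. g (euler_local m d w i) * (euler_local m d w (Suc i) - euler_local m d w i))
    - d * (\<Sum>i<n. g (euler_local m d w i) * m (euler_local m d w i))"
proof (induction n)
  case 0
  then show ?case using assms by simp
next
  case (Suc n)
  have "g (euler_local m d w (Suc n)) * (w (Suc n) + euler_drift m d w (Suc n) + euler_local m d w (Suc n))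
     = g (euler_local m d w n) * (w (Suc n) + euler_drift m d w (Suc n) + euler_local m d w (Suc n))"
  proof (cases "euler_local m d w (Suc n) = euler_local m d w n")
    case False
    then have "w (Suc n) + euler_drift m d w (Suc n) + euler_local m d w (Suc n) = 0"
      by (auto simp: euler_local_Suc max_def split: if_splits)
    then show ?thesis by simp
  qed simp
  then show ?case using Suc by (simp add: euler_drift_Suc algebra_simps)
qed

lemma euler_local_cong:
  assumes "\<And>j. j \<le> i \<Longrightarrow> w j = w' j"
  shows "euler_local m d w i = euler_local m d w' i \<and> euler_drift m d w i = euler_drift m d w' i"
  using assms by (induction i) (simp_all add: euler_local_Suc euler_drift_Suc)

text \<open>
  The left Riemann sum of \<open>\<integral> g dL\<close> along the scheme.
\<close>

definition euler_clock :: "(real \<Rightarrow> real) \<Rightarrow> (real \<Rightarrow> real) \<Rightarrow> real \<Rightarrow> nat \<Rightarrow> (nat \<Rightarrow> real) \<Rightarrow> real" where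
  "euler_clock m g d n w =
     (\<Sum>i<n. g (euler_local m d w i) * (euler_local m d w (Suc i) - euler_local m d w i))"

text \<open>
  The stochastic exponential of \<open>- 2 \<integral> g(L) dB\<close> along the scheme; by Girsanov's theorem it is the
  density that subtracts \<open>2 * g\<close> from the drift.
\<close>

definition euler_weight :: "(real \<Rightarrow> real) \<Rightarrow> (real \<Rightarrow> real) \<Rightarrow> real \<Rightarrow> nat \<Rightarrow> (nat \<Rightarrow> real) \<Rightarrow> real" where
  "euler_weight m g d n w =
     exp (\<Sum>i<n. - 2 * g (euler_local m d w i) * (w (Suc i) - w i)
                - d * (- 2 * g (euler_local m d w i))\<^sup>2 / 2)"

lemma euler_weight_eq:
  assumes "w 0 = 0"
  shows "euler_weight m g d n w = exp (2 * euler_clock m g d n w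
      - 2 * g (euler_local m d w n) * (w n + euler_drift m d w n + euler_local m d w n)
      - 2 * (d * (\<Sum>i<n. g (euler_local m d w i) * (g (euler_local m d w i) - m (euler_local m d w i)))))"
proof -
  have "(\<Sum>i<n. - 2 * g (euler_local m d w i) * (w (Suc i) - w i)
                - d * (- 2 * g (euler_local m d w i))\<^sup>2 / 2)
     = - 2 * (\<Sum>i<n. g (euler_local m d w i) * (w (Suc i) - w i))
       - 2 * (d * (\<Sum>i<n. g (euler_local m d w i) * g (euler_local m d w i)))"
    by (induction n) (simp_all add: power2_eq_square algebra_simps)
  also have "\<dots> = 2 * euler_clock m g d n w
      - 2 * g (euler_local m d w n) * (w n + euler_drift m d w n + euler_local m d w n)
      - 2 * (d * (\<Sum>i<n. g (euler_local m d w i) * (g (euler_local m d w i) - m (euler_local m d w i))))"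
    unfolding euler_summation_by_parts[where w = w, OF assms]
    by (simp add: euler_clock_def right_diff_distrib sum_subtractf)
  finally show ?thesis unfolding euler_weight_def by (rule arg_cong)
qed

text \<open>
  The mesh of the Riemann sum is controlled by the oscillation of the driving path alone, so this
  needs no information on the limit of the scheme.
\<close>

lemma euler_clock_tendsto:
  fixes f :: "real \<Rightarrow> real" and T C K :: real
  assumes T: "0 < T" and f: "continuous_on {0..T} f" "f 0 = 0"
    and m: "\<And>x. \<bar>m x\<bar> \<le> C" and lip: "\<And>x y. \<bar>g x - g y\<bar> \<le> K * \<bar>x - y\<bar>"
  shows "(\<lambda>k. euler_clock m g (T / real (Suc k)) (Suc k) (\<lambda>i. f (T / real (Suc k) * real i))
     - integral {0..euler_local m (T / real (Suc k)) (\<lambda>i. f (T / real (Suc k) * real i)) (Suc k)} g)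
     \<longlonglongrightarrow> 0"
proof (rule LIMSEQ_I)
  fix e :: real assume e: "0 < e"
  have K: "0 \<le> K" using lip[of 0 1] by simp
  have C: "0 \<le> C" using m[of 0] by simp
  have "bounded (f ` {0..T})"
    by (intro compact_imp_bounded compact_continuous_image f) simp
  then obtain F where F: "\<And>t. 0 \<le> t \<Longrightarrow> t \<le> T \<Longrightarrow> \<bar>f t\<bar> \<le> F"
    unfolding bounded_iff by (metis atLeastAtMost_iff imageI real_norm_def)
  have F0: "0 \<le> F" using F[of 0] T by simp
  \<comment> \<open>The local time of the scheme is at most \<open>F + C * T\<close>, so mesh \<open>h\<close> causes an error of at most \<open>h * R\<close>.\<close>
  define R where "R = K * (F + C * T) + 1"
  have R: "0 < R" using K F0 C T by (simp add: R_def add_nonneg_pos)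
  define h where "h = e / (2 * R)"
  have h: "0 < h" "h * R < e" using e R by (auto simp: h_def)
  have "uniformly_continuous_on {0..T} f"
    by (rule compact_uniformly_continuous[OF f(1)]) simp
  from uniformly_continuous_onE[OF this, of "h / 2"] h obtain \<delta> where
    \<delta>: "0 < \<delta>" "\<And>s t. s \<in> {0..T} \<Longrightarrow> t \<in> {0..T} \<Longrightarrow> dist t s < \<delta> \<Longrightarrow> dist (f t) (f s) < h / 2"
    by (metis half_gt_zero)
  have tend: "(\<lambda>k. T / real (Suc k)) \<longlonglongrightarrow> 0"
    by (rule LIMSEQ_Suc[OF lim_const_over_n])
  have "\<forall>\<^sub>F k in sequentially. T / real (Suc k) < \<delta>"
    by (rule order_tendstoD[OF tend]) (use \<delta> in auto)
  moreover have "\<forall>\<^sub>F k in sequentially. T / real (Suc k) < h / 2 / (C + 1)"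
    by (rule order_tendstoD[OF tend]) (use h C in auto)
  ultimately have "\<forall>\<^sub>F k in sequentially. T / real (Suc k) < \<delta> \<and> T / real (Suc k) < h / 2 / (C + 1)"
    by (rule eventually_conj)
  then show "\<exists>k0. \<forall>k\<ge>k0. norm (euler_clock m g (T / real (Suc k)) (Suc k) (\<lambda>i. f (T / real (Suc k) * real i))
     - integral {0..euler_local m (T / real (Suc k)) (\<lambda>i. f (T / real (Suc k) * real i)) (Suc k)} g - 0) < e"
    unfolding eventually_sequentially
  proof (elim exE, intro exI allI impI)
    fix k0 k
    assume "\<forall>n\<ge>k0. T / real (Suc n) < \<delta> \<and> T / real (Suc n) < h / 2 / (C + 1)" "k0 \<le> k"
    then have small: "T / real (Suc k) < \<delta>" "T / real (Suc k) < h / 2 / (C + 1)" by auto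
    define d where "d = T / real (Suc k)"
    have d: "0 < d" "d * real (Suc k) = T" "d < \<delta>" "d * C \<le> h / 2"
    proof -
      show "0 < d" "d * real (Suc k) = T" "d < \<delta>"
        using T small by (auto simp: d_def simp del: of_nat_Suc)
      have "d < h / 2 / (C + 1)" using small(2) by (simp only: d_def)
      then have "d * (C + 1) < h / 2" using C by (subst (asm) pos_less_divide_eq) auto
      then show "d * C \<le> h / 2" using \<open>0 < d\<close> by (simp add: algebra_simps)
    qed
    let ?w = "\<lambda>i. f (d * real i)"
    let ?l = "euler_local m d ?w"
    have grid: "0 \<le> d * real i" "d * real i \<le> T" if "i \<le> Suc k" for i
    proof -
      have "d * real i \<le> d * real (Suc k)" using that d(1) by (intro mult_left_mono) auto
      then show "d * real i \<le> T" by (simp only: d(2))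
    qed (use d in simp)
    have "\<bar>(\<Sum>i<Suc k. g (?l i) * (?l (Suc i) - ?l i)) - integral {?l 0..?l (Suc k)} g\<bar>
       \<le> K * h * (?l (Suc k) - ?l 0)"
    proof (rule left_riemann_sum_error[OF lip])
      fix i assume i: "i < Suc k"
      show "?l i \<le> ?l (Suc i)" by (rule euler_local_mono) simp
      have "dist (f (d * real (Suc i))) (f (d * real i)) < h / 2"
        using grid[of "Suc i"] grid[of i] i d by (intro \<delta>) (auto simp: dist_real_def algebra_simps)
      then have "?l (Suc i) - ?l i \<le> h / 2 + d * C"
        using d f by (intro euler_local_step[OF m]) (auto simp: dist_real_def)
      then show "?l (Suc i) - ?l i \<le> h" using d by simp
    qed
    also have "\<dots> \<le> K * h * (F + C * T)"
    proof -
      have "?l (Suc k) \<le> F + C * (d * real (Suc k))"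
        using d F0 F grid by (intro euler_local_bound[OF m]) auto
      then show ?thesis using d K h by (intro mult_left_mono) auto
    qed
    also have "\<dots> \<le> h * R" using h by (simp add: R_def algebra_simps)
    also have "\<dots> < e" by (rule h)
    finally show "norm (euler_clock m g (T / real (Suc k)) (Suc k) (\<lambda>i. f (T / real (Suc k) * real i))
     - integral {0..euler_local m (T / real (Suc k)) (\<lambda>i. f (T / real (Suc k) * real i)) (Suc k)} g - 0) < e"
      by (simp add: euler_clock_def d_def)
  qed
qed

section \<open>Exponential weights of Gaussian increments\<close>

text \<open>
  Completing the square turns the integrand into the density of a shifted normal law.
\<close>

lemma nn_integral_normal_exp:
  fixes \<theta> \<sigma> :: real
  assumes "0 < \<sigma>"
  shows "(\<integral>\<^sup>+ x. ennreal (exp (\<theta> * x - \<sigma>\<^sup>2 * \<theta>\<^sup>2 / 2)) \<partial>density lborel (\<lambda>x. ennreal (normal_density 0 \<sigma> x))) = 1"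
proof -
  have "normal_density 0 \<sigma> x * exp (\<theta> * x - \<sigma>\<^sup>2 * \<theta>\<^sup>2 / 2) = normal_density (\<sigma>\<^sup>2 * \<theta>) \<sigma> x" for x
  proof -
    have "- (x - 0)\<^sup>2 / (2 * \<sigma>\<^sup>2) + (\<theta> * x - \<sigma>\<^sup>2 * \<theta>\<^sup>2 / 2) = - (x - \<sigma>\<^sup>2 * \<theta>)\<^sup>2 / (2 * \<sigma>\<^sup>2)"
      using assms by (simp add: field_simps power2_eq_square)
    then have "exp (- (x - 0)\<^sup>2 / (2 * \<sigma>\<^sup>2)) * exp (\<theta> * x - \<sigma>\<^sup>2 * \<theta>\<^sup>2 / 2)
        = exp (- (x - \<sigma>\<^sup>2 * \<theta>)\<^sup>2 / (2 * \<sigma>\<^sup>2))"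
      by (simp only: exp_add[symmetric])
    then show ?thesis unfolding normal_density_def by simp
  qed
  then have "(\<integral>\<^sup>+ x. ennreal (exp (\<theta> * x - \<sigma>\<^sup>2 * \<theta>\<^sup>2 / 2)) \<partial>density lborel (\<lambda>x. ennreal (normal_density 0 \<sigma> x)))
     = (\<integral>\<^sup>+ x. ennreal (normal_density (\<sigma>\<^sup>2 * \<theta>) \<sigma> x) \<partial>lborel)"
    by (subst nn_integral_density) (simp_all add: ennreal_mult'[symmetric])
  also have "\<dots> = 1"
    by (subst nn_integral_eq_integral) (use assms in auto)
  finally show ?thesis .
qed

text \<open>
  Integrating out the last coordinate first: \<open>\<theta> n\<close> does not depend on it, so its factor integrates
  to 1 and the product shortens by one.
\<close>

lemma nn_integral_exponential_martingale:
  fixes \<theta> :: "nat \<Rightarrow> (nat \<Rightarrow> real) \<Rightarrow> real" and d :: real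
  defines "N \<equiv> density lborel (\<lambda>x. ennreal (normal_density 0 (sqrt d) x))"
  assumes d: "0 < d"
    and adapted: "\<And>i x y. (\<And>j. j < i \<Longrightarrow> x j = y j) \<Longrightarrow> \<theta> i x = \<theta> i y"
    and meas: "\<And>i n. i \<le> n \<Longrightarrow> \<theta> i \<in> borel_measurable (Pi\<^sub>M {..<n} (\<lambda>_. N))"
  shows "(\<integral>\<^sup>+ x. ennreal (exp (\<Sum>i<n. \<theta> i x * x i - d * (\<theta> i x)\<^sup>2 / 2)) \<partial>Pi\<^sub>M {..<n} (\<lambda>_. N)) = 1"
proof (induction n)
  case 0
  show ?case by (simp add: lessThan_0 PiM_empty nn_integral_count_space_finite)
next
  case (Suc n)
  interpret N: prob_space N
    unfolding N_def using d by (intro prob_space_normal_density) simp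
  interpret P: product_sigma_finite "\<lambda>_::nat. N" ..
  have setsN [measurable_cong]: "sets N = sets borel" by (simp add: N_def)
  note meas [measurable]
  have coord: "(\<lambda>x. x i) \<in> borel_measurable (Pi\<^sub>M {..<m} (\<lambda>_. N))" if "i < m" for i m
  proof -
    have "(\<lambda>x. x i) \<in> Pi\<^sub>M {..<m} (\<lambda>_. N) \<rightarrow>\<^sub>M N"
      using that by (intro measurable_component_singleton) simp
    then show ?thesis using measurable_cong_sets[OF refl setsN] by blast
  qed
  let ?f = "\<lambda>n x. ennreal (exp (\<Sum>i<n. \<theta> i x * x i - d * (\<theta> i x)\<^sup>2 / 2))"
  have fm: "?f m \<in> borel_measurable (Pi\<^sub>M {..<m} (\<lambda>_. N))" for m
    by (intro measurable_compose[OF _ measurable_ennreal] measurable_compose[OF _ borel_measurable_exp] borel_measurable_sum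
        borel_measurable_diff borel_measurable_times borel_measurable_divide borel_measurable_power coord meas) auto
  have "(\<integral>\<^sup>+ x. ?f (Suc n) x \<partial>Pi\<^sub>M {..<Suc n} (\<lambda>_. N)) = (\<integral>\<^sup>+ x. ?f (Suc n) x \<partial>Pi\<^sub>M (insert n {..<n}) (\<lambda>_. N))"
    by (simp only: lessThan_Suc)
  also have "\<dots> = (\<integral>\<^sup>+ x. (\<integral>\<^sup>+ y. ?f (Suc n) (x(n := y)) \<partial>N) \<partial>Pi\<^sub>M {..<n} (\<lambda>_. N))"
    using fm[of "Suc n"] by (intro P.product_nn_integral_insert) (simp_all add: lessThan_Suc)
  also have "\<dots> = (\<integral>\<^sup>+ x. ?f n x \<partial>Pi\<^sub>M {..<n} (\<lambda>_. N))"
  proof (rule nn_integral_cong)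
    fix x
    have eq: "\<theta> i (x(n := y)) = \<theta> i x" if "i \<le> n" for i y
      using that by (intro adapted) auto
    have "?f (Suc n) (x(n := y)) = ?f n x * ennreal (exp (\<theta> n x * y - (sqrt d)\<^sup>2 * (\<theta> n x)\<^sup>2 / 2))" for y
    proof -
      have "(\<Sum>i<n. \<theta> i (x(n := y)) * (x(n := y)) i - d * (\<theta> i (x(n := y)))\<^sup>2 / 2)
          = (\<Sum>i<n. \<theta> i x * x i - d * (\<theta> i x)\<^sup>2 / 2)"
        by (intro sum.cong) (simp_all add: eq)
      then show ?thesis using d
        by (simp add: eq exp_add exp_diff ennreal_mult'[symmetric])
    qed
    then have "(\<integral>\<^sup>+ y. ?f (Suc n) (x(n := y)) \<partial>N) =
        (\<integral>\<^sup>+ y. ?f n x * ennreal (exp (\<theta> n x * y - (sqrt d)\<^sup>2 * (\<theta> n x)\<^sup>2 / 2)) \<partial>N)"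
      by simp
    also have "\<dots> = ?f n x * (\<integral>\<^sup>+ y. ennreal (exp (\<theta> n x * y - (sqrt d)\<^sup>2 * (\<theta> n x)\<^sup>2 / 2)) \<partial>N)"
      by (rule nn_integral_cmult) measurable
    also have "\<dots> = ?f n x"
      unfolding N_def by (subst nn_integral_normal_exp) (use d in auto)
    finally show "(\<integral>\<^sup>+ y. ?f (Suc n) (x(n := y)) \<partial>N) = ?f n x" .
  qed
  finally show ?case using Suc by simp
qed

context brownian_motion begin

lemma increments_joint_law:
  fixes d :: real
  assumes d: "0 < d"
  defines "N \<equiv> density lborel (\<lambda>x. ennreal (normal_density 0 (sqrt d) x))"
  shows "distr M (Pi\<^sub>M {..<n} (\<lambda>_. N)) (\<lambda>\<omega>. \<lambda>i\<in>{..<n}. B (d * real (Suc i)) \<omega> - B (d * real i) \<omega>)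
       = Pi\<^sub>M {..<n} (\<lambda>_. N)"
    and "(\<lambda>\<omega>. \<lambda>i\<in>{..<n}. B (d * real (Suc i)) \<omega> - B (d * real i) \<omega>) \<in> M \<rightarrow>\<^sub>M Pi\<^sub>M {..<n} (\<lambda>_. N)"
proof -
  have setsN: "sets N = sets borel" by (simp add: N_def)
  have meas: "(\<lambda>\<omega>. B (d * real (Suc i)) \<omega> - B (d * real i) \<omega>) \<in> borel_measurable M" for i
    using d by (intro borel_measurable_diff measurable_at) auto
  have law: "distr M borel (\<lambda>\<omega>. B (d * real (Suc i)) \<omega> - B (d * real i) \<omega>) = N" for i
  proof -
    have "distributed M lborel (\<lambda>\<omega>. B (d * real (Suc i)) \<omega> - B (d * real i) \<omega>)
      (normal_density 0 (sqrt (d * real (Suc i) - d * real i)))"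
      using d by (intro normal_increments) auto
    moreover have "d * real (Suc i) - d * real i = d" by (simp add: algebra_simps)
    ultimately have "distr M lborel (\<lambda>\<omega>. B (d * real (Suc i)) \<omega> - B (d * real i) \<omega>) = N"
      unfolding N_def distributed_def by simp
    then show ?thesis by (metis distr_cong sets_lborel)
  qed
  have mono: "mono_on {..n} (\<lambda>i. d * real i)"
    using d by (auto intro!: mono_onI)
  have ind: "indep_vars (\<lambda>_. borel) (\<lambda>i \<omega>. B (d * real (Suc i)) \<omega> - B (d * real i) \<omega>) {..<n}"
    using indep_increments[of "\<lambda>i. d * real i" n] mono d by simp
  have sets: "sets (Pi\<^sub>M {..<n} (\<lambda>_. N)) = sets (Pi\<^sub>M {..<n} (\<lambda>_. borel))"
    by (rule sets_PiM_cong) (simp_all add: setsN)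
  show joint: "(\<lambda>\<omega>. \<lambda>i\<in>{..<n}. B (d * real (Suc i)) \<omega> - B (d * real i) \<omega>) \<in> M \<rightarrow>\<^sub>M Pi\<^sub>M {..<n} (\<lambda>_. N)"
    unfolding measurable_cong_sets[OF refl sets]
    by (intro measurable_restrict meas)
  show "distr M (Pi\<^sub>M {..<n} (\<lambda>_. N)) (\<lambda>\<omega>. \<lambda>i\<in>{..<n}. B (d * real (Suc i)) \<omega> - B (d * real i) \<omega>)
       = Pi\<^sub>M {..<n} (\<lambda>_. N)"
  proof (cases "n = 0")
    case True
    interpret P: prob_space "distr M (Pi\<^sub>M {..<0} (\<lambda>_. N)) (\<lambda>\<omega>. \<lambda>i\<in>{..<0}. B (d * real (Suc i)) \<omega> - B (d * real i) \<omega>)"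
      by (rule prob_space_distr) (use joint True in simp)
    show ?thesis unfolding True
      using P.emeasure_space_1
      by (intro measure_eqI) (auto simp: PiM_empty dest!: subset_singletonD)
  next
    case False
    have "distr M (Pi\<^sub>M {..<n} (\<lambda>_. N)) (\<lambda>\<omega>. \<lambda>i\<in>{..<n}. B (d * real (Suc i)) \<omega> - B (d * real i) \<omega>)
       = distr M (Pi\<^sub>M {..<n} (\<lambda>_. borel)) (\<lambda>\<omega>. \<lambda>i\<in>{..<n}. B (d * real (Suc i)) \<omega> - B (d * real i) \<omega>)"
      by (rule distr_cong[OF refl sets refl])
    also have "\<dots> = Pi\<^sub>M {..<n} (\<lambda>i. distr M borel (\<lambda>\<omega>. B (d * real (Suc i)) \<omega> - B (d * real i) \<omega>))"
      using indep_vars_iff_distr_eq_PiM[of "{..<n}" "\<lambda>i \<omega>. B (d * real (Suc i)) \<omega> - B (d * real i) \<omega>" "\<lambda>_. borel"]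
        ind meas False by blast
    finally show ?thesis by (simp only: law)
  qed
qed

lemma euler_measurable:
  assumes [measurable]: "m \<in> borel_measurable borel" and d: "0 < d"
  shows "(\<lambda>\<omega>. euler_local m d (\<lambda>i. B (d * real i) \<omega>) i) \<in> borel_measurable M"
proof -
  have [measurable]: "B (d * real j) \<in> borel_measurable M" for j
    using d by (intro measurable_at) simp
  have "(\<lambda>\<omega>. euler_local m d (\<lambda>i. B (d * real i) \<omega>) i) \<in> borel_measurable M \<and>
    (\<lambda>\<omega>. euler_drift m d (\<lambda>i. B (d * real i) \<omega>) i) \<in> borel_measurable M"
  proof (induction i)
    case (Suc i)
    then have [measurable]: "(\<lambda>\<omega>. euler_local m d (\<lambda>i. B (d * real i) \<omega>) i) \<in> borel_measurable M"
      "(\<lambda>\<omega>. euler_drift m d (\<lambda>i. B (d * real i) \<omega>) i) \<in> borel_measurable M" by auto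
    have [measurable]: "(\<lambda>\<omega>. euler_drift m d (\<lambda>i. B (d * real i) \<omega>) (Suc i)) \<in> borel_measurable M"
      unfolding euler_drift_Suc by measurable
    show ?case unfolding euler_local_Suc by (intro conjI) measurable
  qed simp
  then show ?thesis ..
qed

text \<open>
  The scheme is rewritten as a function of the vector of increments, whose law is a product measure.
\<close>

lemma nn_integral_euler_exponential:
  assumes [measurable]: "m \<in> borel_measurable borel" "h \<in> borel_measurable borel" and d: "0 < d"
  defines "l \<equiv> \<lambda>i \<omega>. euler_local m d (\<lambda>i. B (d * real i) \<omega>) i"
  shows "(\<integral>\<^sup>+ \<omega>. ennreal (exp (\<Sum>i<n. h (l i \<omega>) * (B (d * real (Suc i)) \<omega> - B (d * real i) \<omega>)
            - d * (h (l i \<omega>))\<^sup>2 / 2)) \<partial>M) = 1"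
proof -
  define N where "N = density lborel (\<lambda>x. ennreal (normal_density 0 (sqrt d) x))"
  define w where "w x j = (\<Sum>i<j. x i)" for x :: "nat \<Rightarrow> real" and j
  define \<theta> where "\<theta> i x = h (euler_local m d (w x) i)" for i x
  define J where "J \<omega> = (\<lambda>i\<in>{..<n}. B (d * real (Suc i)) \<omega> - B (d * real i) \<omega>)" for \<omega>
  have setsN: "sets N = sets borel" by (simp add: N_def)
  have coord [measurable]: "(\<lambda>x. x i) \<in> borel_measurable (Pi\<^sub>M {..<k} (\<lambda>_. N))" if "i < k" for i k
  proof -
    have "(\<lambda>x. x i) \<in> Pi\<^sub>M {..<k} (\<lambda>_. N) \<rightarrow>\<^sub>M N"
      using that by (intro measurable_component_singleton) simp
    then show ?thesis using measurable_cong_sets[OF refl setsN] by blast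
  qed
  have w_meas: "(\<lambda>x. w x j) \<in> borel_measurable (Pi\<^sub>M {..<k} (\<lambda>_. N))" if "j \<le> k" for j k
    unfolding w_def using that by (intro borel_measurable_sum coord) auto
  have euler_meas: "(\<lambda>x. euler_local m d (w x) i) \<in> borel_measurable (Pi\<^sub>M {..<k} (\<lambda>_. N)) \<and>
    (\<lambda>x. euler_drift m d (w x) i) \<in> borel_measurable (Pi\<^sub>M {..<k} (\<lambda>_. N))" if "i \<le> k" for i k
    using that
  proof (induction i)
    case (Suc i)
    then have [measurable]: "(\<lambda>x. euler_local m d (w x) i) \<in> borel_measurable (Pi\<^sub>M {..<k} (\<lambda>_. N))"
      "(\<lambda>x. euler_drift m d (w x) i) \<in> borel_measurable (Pi\<^sub>M {..<k} (\<lambda>_. N))"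
      "(\<lambda>x. w x (Suc i)) \<in> borel_measurable (Pi\<^sub>M {..<k} (\<lambda>_. N))"
      using w_meas[OF Suc.prems] by auto
    have [measurable]: "(\<lambda>x. euler_drift m d (w x) (Suc i)) \<in> borel_measurable (Pi\<^sub>M {..<k} (\<lambda>_. N))"
      unfolding euler_drift_Suc by measurable
    show ?case unfolding euler_local_Suc by (intro conjI) measurable
  qed simp
  have \<theta>_meas: "\<theta> i \<in> borel_measurable (Pi\<^sub>M {..<k} (\<lambda>_. N))" if "i \<le> k" for i k
    unfolding \<theta>_def using euler_meas[OF that] by (intro measurable_compose[OF _ assms(2)]) auto
  have adapted: "\<theta> i x = \<theta> i y" if "\<And>j. j < i \<Longrightarrow> x j = y j" for i x y
  proof -
    have "euler_local m d (w x) i = euler_local m d (w y) i"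
      using that by (intro conjunct1[OF euler_local_cong]) (auto simp: w_def intro!: sum.cong)
    then show ?thesis by (simp add: \<theta>_def)
  qed
  have J: "J \<in> M \<rightarrow>\<^sub>M Pi\<^sub>M {..<n} (\<lambda>_. N)" "distr M (Pi\<^sub>M {..<n} (\<lambda>_. N)) J = Pi\<^sub>M {..<n} (\<lambda>_. N)"
    using increments_joint_law[OF d, of n] by (simp_all only: J_def[abs_def] N_def)
  have path: "w (J \<omega>) j = B (d * real j) \<omega>" if "\<omega> \<in> space M" "j \<le> n" for \<omega> j
  proof -
    have "w (J \<omega>) j = (\<Sum>i<j. B (d * real (Suc i)) \<omega> - B (d * real i) \<omega>)"
      unfolding w_def using that by (intro sum.cong) (auto simp: J_def)
    also have "\<dots> = B (d * real j) \<omega> - B (d * real 0) \<omega>"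
      by (rule sum_lessThan_telescope[of "\<lambda>i. B (d * real i) \<omega>"])
    finally show ?thesis using start that by simp
  qed
  have \<theta>_path: "\<theta> i (J \<omega>) = h (l i \<omega>)" if "\<omega> \<in> space M" "i \<le> n" for \<omega> i
  proof -
    have "euler_local m d (w (J \<omega>)) i = l i \<omega>"
      unfolding l_def using that path by (intro conjunct1[OF euler_local_cong]) auto
    then show ?thesis by (simp add: \<theta>_def)
  qed
  let ?f = "\<lambda>x. ennreal (exp (\<Sum>i<n. \<theta> i x * x i - d * (\<theta> i x)\<^sup>2 / 2))"
  have fm: "?f \<in> borel_measurable (Pi\<^sub>M {..<n} (\<lambda>_. N))"
    by (intro measurable_compose[OF _ measurable_ennreal] measurable_compose[OF _ borel_measurable_exp] borel_measurable_sum
        borel_measurable_diff borel_measurable_times borel_measurable_divide borel_measurable_power coord \<theta>_meas) auto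
  have "(\<integral>\<^sup>+ \<omega>. ennreal (exp (\<Sum>i<n. h (l i \<omega>) * (B (d * real (Suc i)) \<omega> - B (d * real i) \<omega>)
            - d * (h (l i \<omega>))\<^sup>2 / 2)) \<partial>M) = (\<integral>\<^sup>+ \<omega>. ?f (J \<omega>) \<partial>M)"
  proof (rule nn_integral_cong)
    fix \<omega> assume "\<omega> \<in> space M"
    then have "(\<Sum>i<n. h (l i \<omega>) * (B (d * real (Suc i)) \<omega> - B (d * real i) \<omega>) - d * (h (l i \<omega>))\<^sup>2 / 2)
      = (\<Sum>i<n. \<theta> i (J \<omega>) * J \<omega> i - d * (\<theta> i (J \<omega>))\<^sup>2 / 2)"
      by (intro sum.cong) (auto simp: \<theta>_path, simp add: J_def)
    then show "ennreal (exp (\<Sum>i<n. h (l i \<omega>) * (B (d * real (Suc i)) \<omega> - B (d * real i) \<omega>)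
            - d * (h (l i \<omega>))\<^sup>2 / 2)) = ?f (J \<omega>)" by simp
  qed
  also have "\<dots> = (\<integral>\<^sup>+ x. ?f x \<partial>distr M (Pi\<^sub>M {..<n} (\<lambda>_. N)) J)"
    using J(1) fm by (simp add: nn_integral_distr)
  also have "\<dots> = 1"
    unfolding J(2) unfolding N_def
    by (rule nn_integral_exponential_martingale[OF d adapted \<theta>_meas[unfolded N_def]])
  finally show ?thesis .
qed

text \<open>
  The square of the weight for \<open>g\<close> is the weight for \<open>2 * g\<close> times a factor that the bound on \<open>g\<close>
  controls. The bound on the second moment depends on the total time \<open>d * n\<close> only, so it persists
  when the mesh is refined.
\<close>

lemma euler_weight_moments:
  fixes n :: nat
  assumes m [measurable]: "m \<in> borel_measurable borel" and g [measurable]: "g \<in> borel_measurable borel"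
    and bound: "\<And>x. \<bar>g x\<bar> \<le> G" and d: "0 < d"
  defines "W \<equiv> \<lambda>\<omega>. euler_weight m g d n (\<lambda>i. B (d * real i) \<omega>)"
  shows "integrable M W" "expectation W = 1"
    "integrable M (\<lambda>\<omega>. (W \<omega>)\<^sup>2)" "expectation (\<lambda>\<omega>. (W \<omega>)\<^sup>2) \<le> exp (4 * G\<^sup>2 * (d * real n))"
proof -
  let ?l = "\<lambda>i \<omega>. euler_local m d (\<lambda>i. B (d * real i) \<omega>) i"
  let ?D = "\<lambda>i \<omega>. B (d * real (Suc i)) \<omega> - B (d * real i) \<omega>"
  have [measurable]: "(\<lambda>\<omega>. ?l i \<omega>) \<in> borel_measurable M" for i
    by (rule euler_measurable[OF m d])
  have [measurable]: "B (d * real j) \<in> borel_measurable M" for j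
    using d by (intro measurable_at) simp
  have Wm [measurable]: "W \<in> borel_measurable M"
    unfolding W_def euler_weight_def by measurable
  have W1: "(\<integral>\<^sup>+ \<omega>. ennreal (W \<omega>) \<partial>M) = 1"
    using nn_integral_euler_exponential[of m "\<lambda>x. - 2 * g x" d n] d
    by (simp add: W_def euler_weight_def)
  have Wpos: "0 \<le> W \<omega>" for \<omega> by (simp add: W_def euler_weight_def)
  show int: "integrable M W"
    using W1 Wpos by (intro integrableI_nonneg) auto
  show "expectation W = 1"
    using W1 Wpos by (simp add: integral_eq_nn_integral)
  have sq: "(W \<omega>)\<^sup>2 \<le> exp (4 * G\<^sup>2 * (d * real n)) *
      exp (\<Sum>i<n. (- 4 * g (?l i \<omega>)) * ?D i \<omega> - d * (- 4 * g (?l i \<omega>))\<^sup>2 / 2)" for \<omega>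
  proof -
    have "(W \<omega>)\<^sup>2 = exp (\<Sum>i<n. 2 * (- 2 * g (?l i \<omega>) * ?D i \<omega> - d * (- 2 * g (?l i \<omega>))\<^sup>2 / 2))"
      unfolding W_def euler_weight_def power2_eq_square[of "exp _"]
      by (simp only: exp_add[symmetric] sum_distrib_left[symmetric]) simp
    also have "\<dots> \<le> exp (\<Sum>i<n. 4 * G\<^sup>2 * d + ((- 4 * g (?l i \<omega>)) * ?D i \<omega> - d * (- 4 * g (?l i \<omega>))\<^sup>2 / 2))"
    proof (subst exp_le_cancel_iff, rule sum_mono)
      fix i
      have "(g (?l i \<omega>))\<^sup>2 \<le> G\<^sup>2"
        using bound[of "?l i \<omega>"] by (metis abs_ge_zero power2_abs power_mono)
      then have "d * (g (?l i \<omega>))\<^sup>2 \<le> d * G\<^sup>2" using d by (simp add: mult_left_mono)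
      then show "2 * (- 2 * g (?l i \<omega>) * ?D i \<omega> - d * (- 2 * g (?l i \<omega>))\<^sup>2 / 2)
         \<le> 4 * G\<^sup>2 * d + ((- 4 * g (?l i \<omega>)) * ?D i \<omega> - d * (- 4 * g (?l i \<omega>))\<^sup>2 / 2)"
        by (simp add: power2_eq_square algebra_simps)
    qed
    also have "\<dots> = exp (4 * G\<^sup>2 * (d * real n)) *
      exp (\<Sum>i<n. (- 4 * g (?l i \<omega>)) * ?D i \<omega> - d * (- 4 * g (?l i \<omega>))\<^sup>2 / 2)"
      by (subst sum.distrib) (simp add: exp_add[symmetric] algebra_simps)
    finally show ?thesis .
  qed
  have "(\<integral>\<^sup>+ \<omega>. ennreal ((W \<omega>)\<^sup>2) \<partial>M) \<le> (\<integral>\<^sup>+ \<omega>. ennreal (exp (4 * G\<^sup>2 * (d * real n))) *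
      ennreal (exp (\<Sum>i<n. (- 4 * g (?l i \<omega>)) * ?D i \<omega> - d * (- 4 * g (?l i \<omega>))\<^sup>2 / 2)) \<partial>M)"
    using sq by (intro nn_integral_mono) (simp add: ennreal_mult'[symmetric] ennreal_leI del: ennreal_mult'')
  also have "\<dots> = ennreal (exp (4 * G\<^sup>2 * (d * real n))) * (\<integral>\<^sup>+ \<omega>. 
      ennreal (exp (\<Sum>i<n. (- 4 * g (?l i \<omega>)) * ?D i \<omega> - d * (- 4 * g (?l i \<omega>))\<^sup>2 / 2)) \<partial>M)"
    by (rule nn_integral_cmult) measurable
  also have "\<dots> = ennreal (exp (4 * G\<^sup>2 * (d * real n)))"
    using nn_integral_euler_exponential[of m "\<lambda>x. - 4 * g x" d n] d by simp
  finally have W2: "(\<integral>\<^sup>+ \<omega>. ennreal ((W \<omega>)\<^sup>2) \<partial>M) \<le> ennreal (exp (4 * G\<^sup>2 * (d * real n)))" .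
  show int2: "integrable M (\<lambda>\<omega>. (W \<omega>)\<^sup>2)"
    using W2 by (intro integrableI_nonneg) (auto simp: top_unique intro: le_less_trans)
  have "ennreal (expectation (\<lambda>\<omega>. (W \<omega>)\<^sup>2)) \<le> ennreal (exp (4 * G\<^sup>2 * (d * real n)))"
    using W2 int2 by (subst nn_integral_eq_integral[symmetric]) auto
  then show "expectation (\<lambda>\<omega>. (W \<omega>)\<^sup>2) \<le> exp (4 * G\<^sup>2 * (d * real n))"
    by (subst (asm) ennreal_le_iff) auto
qed

end

section \<open>The local time of a single path\<close>

text \<open>
  Everything that holds for one fixed path, without probability.
\<close>

locale local_time_path =
  fixes \<mu> f L :: "real \<Rightarrow> real"
  assumes cont_drift: "continuous_on {0..} \<mu>"
    and cont_path: "continuous_on {0..} f"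
    and local_time: "is_local_time \<mu> f L"
begin

text \<open>
  The path before reflection: the reflected path is \<open>free_path t + L t\<close>.
\<close>

definition free_path :: "real \<Rightarrow> real" where
  "free_path t = f t + integral {0..t} (\<lambda>s. \<mu> (L s))"

lemma cont_local: "continuous_on {0..} L"
  using local_time unfolding is_local_time_def by blast

lemma local_0: "L 0 = 0"
  using local_time unfolding is_local_time_def by blast

lemma local_mono: "\<lbrakk>0 \<le> s; s \<le> t\<rbrakk> \<Longrightarrow> L s \<le> L t"
  using local_time unfolding is_local_time_def by (blast intro: mono_onD[of "{0..}" L] order_trans)

lemma local_nonneg: "0 \<le> t \<Longrightarrow> 0 \<le> L t"
  using local_mono[of 0 t] local_0 by simp

lemma cont_drift_local: "continuous_on {0..} (\<lambda>s. \<mu> (L s))"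
  by (rule continuous_on_compose2[OF cont_drift cont_local]) (use local_nonneg in auto)

lemma drift_local_integrable: "0 \<le> a \<Longrightarrow> (\<lambda>s. \<mu> (L s)) integrable_on {a..b}"
  by (rule integrable_continuous_real, rule continuous_on_subset[OF cont_drift_local]) auto

lemma cont_free_path: "continuous_on {0..T} free_path"
  unfolding free_path_def
proof (rule continuous_on_add)
  show "continuous_on {0..T} f" by (rule continuous_on_subset[OF cont_path]) auto
  show "continuous_on {0..T} (\<lambda>t. integral {0..t} (\<lambda>s. \<mu> (L s)))"
    by (rule indefinite_integral_continuous_1, rule drift_local_integrable) simp
qed

lemma reflected_path_eq:
  assumes "0 \<le> t"
  shows "reflected_path \<mu> f L t = free_path t + L t"
proof -
  have "set_integrable lborel {0..t} (\<lambda>s. \<mu> (L s))"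
    by (rule borel_integrable_atLeastAtMost', rule continuous_on_subset[OF cont_drift_local]) auto
  from set_borel_integral_eq_integral(2)[OF this]
  show ?thesis by (simp add: reflected_path_def free_path_def)
qed

lemma reflected_nonneg: "0 \<le> t \<Longrightarrow> 0 \<le> free_path t + L t"
  using local_time reflected_path_eq[of t] unfolding is_local_time_def by fastforce

lemma local_constant_off_boundary:
  assumes ab: "0 \<le> a" "a \<le> b" and pos: "\<And>s. a < s \<Longrightarrow> s \<le> b \<Longrightarrow> 0 < free_path s + L s"
  shows "L a = L b"
proof -
  let ?F = "\<lambda>s. L (max s 0)"
  have "continuous_on UNIV ?F"
    by (rule continuous_on_compose2[OF cont_local]) (auto intro!: continuous_intros)
  then have "continuous (at_right x) ?F" for x
    by (simp add: continuous_on_eq_continuous_at continuous_at_imp_continuous_at_within)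
  moreover have "?F x \<le> ?F y" if "x \<le> y" for x y using that by (intro local_mono) auto
  ultimately have "emeasure (interval_measure ?F) {a<..b} = ennreal (?F b - ?F a)"
    using ab by (intro emeasure_interval_measure_Ioc) auto
  also have "\<dots> = ennreal (L b - L a)" using ab by simp
  finally have "ennreal (L b - L a) = (\<integral>\<^sup>+ s. indicator {a<..b} s \<partial>interval_measure ?F)"
    by (simp add: nn_integral_indicator)
  also have "\<dots> \<le> (\<integral>\<^sup>+ s\<in>{0..}. indicator {s. 0 < reflected_path \<mu> f L s} s \<partial>interval_measure ?F)"
    using ab pos by (intro nn_integral_mono) (auto split: split_indicator simp: reflected_path_eq)
  also have "\<dots> = 0" using local_time by (simp add: is_local_time_def)
  finally have "L b \<le> L a" by (simp add: ennreal_eq_0_iff)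
  with local_mono[OF ab] show ?thesis by simp
qed

text \<open>
  This replaces the Skorohod formula for \<open>L\<close> as a running maximum of \<open>- free_path\<close>: at the first time
  \<open>u\<close> at which the final value \<open>L t\<close> is attained the reflected path must be 0, since otherwise it
  would be positive shortly before \<open>u\<close> and \<open>L\<close> would have been constant there.
\<close>

lemma local_touches_boundary:
  assumes st: "0 \<le> s" "s \<le> t"
  shows "L t = L s \<or> (\<exists>u\<in>{s..t}. L t = - free_path u)"
proof (cases "L t = L s")
  assume ne: "L t \<noteq> L s"
  let ?U = "{u\<in>{s..t}. L u = L t}"
  have cont: "continuous_on {s..t} L"
    by (rule continuous_on_subset[OF cont_local]) (use st in auto)
  have "closed ?U"
    using continuous_closed_preimage_constant[OF cont] by simp
  moreover have "t \<in> ?U" "bdd_below ?U" using st by auto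
  ultimately have U: "Inf ?U \<in> ?U" by (intro closed_contains_Inf) auto
  define u where "u = Inf ?U"
  have u: "s \<le> u" "u \<le> t" "L u = L t" using U by (auto simp: u_def)
  have first: "u \<le> v" if "v \<in> ?U" for v
    unfolding u_def using that \<open>bdd_below ?U\<close> by (rule cInf_lower)
  have su: "s < u" using u ne by (cases "s = u") auto
  have "free_path u + L u = 0"
  proof (rule ccontr)
    assume "free_path u + L u \<noteq> 0"
    then have pos: "0 < free_path u + L u" using reflected_nonneg[of u] st u by force
    have "continuous_on {s..u} (\<lambda>r. free_path r + L r)"
    proof (rule continuous_on_add)
      show "continuous_on {s..u} free_path"
        by (rule continuous_on_subset[OF cont_free_path[of u]]) (use st in auto)
      show "continuous_on {s..u} L"
        by (rule continuous_on_subset[OF cont_local]) (use st in auto)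
    qed
    then have "\<forall>\<^sub>F r in at u within {s..u}. 0 < free_path r + L r"
      using pos su by (intro order_tendstoD(1)[of _ "free_path u + L u"])
        (auto simp: continuous_on_def)
    then obtain e where e: "0 < e" "\<And>r. r \<in> {s..u} \<Longrightarrow> r \<noteq> u \<Longrightarrow> dist r u < e \<Longrightarrow> 0 < free_path r + L r"
      unfolding eventually_at by blast
    \<comment> \<open>Positivity holds on a left neighbourhood of \<open>u\<close>, so \<open>L\<close> takes the value \<open>L u\<close> already at \<open>v\<close>.\<close>
    define v where "v = max s (u - e / 2)"
    have v: "s \<le> v" "v < u" using su e by (auto simp: v_def)
    have "L v = L u"
    proof (rule local_constant_off_boundary)
      show "0 < free_path r + L r" if "v < r" "r \<le> u" for r
        using that pos e v by (cases "r = u") (auto simp: v_def dist_real_def)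
    qed (use v st in auto)
    then have "v \<in> ?U" using u v by auto
    from first[OF this] v show False by simp
  qed
  then have "L t = - free_path u" using u by simp
  then show ?thesis using u by auto
qed simp

text \<open>
  A discrete Gronwall argument. The error of the drift at step \<open>i\<close> is at most \<open>E i\<close>, the error of the
  local time at most \<open>E i + \<eta>\<close>, and one step multiplies \<open>E i + 2 * \<eta>\<close> by \<open>1 + d * K\<close>. The comparison
  stops at a time \<open>S\<close> with \<open>L S \<le> c\<close> because \<open>m\<close> and \<open>\<mu>\<close> agree only up to the level \<open>c\<close>.
\<close>

lemma euler_tracks_local:
  fixes d K \<eta> S c :: real
  assumes d: "0 < d" and lip: "\<And>x y. \<bar>m x - m y\<bar> \<le> K * \<bar>x - y\<bar>"
    and agree: "\<And>x. 0 \<le> x \<Longrightarrow> x \<le> c \<Longrightarrow> m x = \<mu> x"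
    and S: "0 \<le> S" "L S \<le> c"
    and osc: "\<And>s t. 0 \<le> s \<Longrightarrow> s \<le> t \<Longrightarrow> t \<le> S \<Longrightarrow> t - s \<le> d \<Longrightarrow>
       \<bar>L s - L t\<bar> \<le> \<eta> \<and> \<bar>free_path s - free_path t\<bar> \<le> \<eta>"
    and i: "d * real i \<le> S"
  shows "\<bar>euler_local m d (\<lambda>i. f (d * real i)) i - L (d * real i)\<bar> \<le> 2 * \<eta> * exp (K * S)"
proof -
  let ?w = "\<lambda>i. f (d * real i)"
  let ?A = "euler_drift m d ?w" and ?L = "euler_local m d ?w"
  let ?a = "\<lambda>t. integral {0..t} (\<lambda>s. \<mu> (L s))"
  define E where "E i = 2 * \<eta> * ((1 + d * K) ^ i - 1)" for i :: nat
  have K: "0 \<le> K" using lip[of 0 1] by simp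
  have \<eta>: "0 \<le> \<eta>" using osc[of 0 0] S d by simp
  have E_mono: "E i \<le> E (Suc i)" for i
    unfolding E_def using \<eta> d K by (intro mult_left_mono diff_right_mono power_increasing) auto
  have track: "\<bar>?A i - ?a (d * real i)\<bar> \<le> E i \<and> \<bar>?L i - L (d * real i)\<bar> \<le> E i + \<eta>"
    if "d * real i \<le> S" for i
    using that
  proof (induction i)
    case 0
    then show ?case using local_0 \<eta> by (simp add: E_def)
  next
    case (Suc i)
    define s t where "s = d * real i" and "t = d * real (Suc i)"
    have st: "0 \<le> s" "s \<le> t" "t - s = d" "t \<le> S"
      using d Suc.prems by (auto simp: s_def t_def algebra_simps)
    then have IH: "\<bar>?A i - ?a s\<bar> \<le> E i" "\<bar>?L i - L s\<bar> \<le> E i + \<eta>"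
      using Suc.IH by (auto simp: s_def)
    have "?a t = ?a s + integral {s..t} (\<lambda>s. \<mu> (L s))"
      using st drift_local_integrable[of 0 t]
      by (simp add: Henstock_Kurzweil_Integration.integral_combine)
    moreover have "\<bar>d * m (?L i) - integral {s..t} (\<lambda>s. \<mu> (L s))\<bar> \<le> K * (E i + 2 * \<eta>) * d"
    proof -
      have "d * m (?L i) - integral {s..t} (\<lambda>s. \<mu> (L s)) = integral {s..t} (\<lambda>r. m (?L i) - \<mu> (L r))"
        using st drift_local_integrable[of s t]
        by (subst Henstock_Kurzweil_Integration.integral_diff) auto
      moreover have "norm (integral {s..t} (\<lambda>r. m (?L i) - \<mu> (L r))) \<le> K * (E i + 2 * \<eta>) * (t - s)"
      proof (rule integral_bound[OF st(2)])
        show "continuous_on {s..t} (\<lambda>r. m (?L i) - \<mu> (L r))"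
          by (intro continuous_on_diff continuous_on_const, rule continuous_on_subset[OF cont_drift_local])
            (use st in auto)
        fix r assume r: "r \<in> {s..t}"
        have "L r \<le> c" "0 \<le> L r" using r st S local_mono[of r S] local_nonneg[of r] by auto
        then have "norm (m (?L i) - \<mu> (L r)) \<le> K * \<bar>?L i - L r\<bar>"
          using lip[of "?L i" "L r"] agree[of "L r"] by simp
        also have "\<dots> \<le> K * (E i + 2 * \<eta>)"
          using K IH(2) osc[of s r] r st by (intro mult_left_mono) auto
        finally show "norm (m (?L i) - \<mu> (L r)) \<le> K * (E i + 2 * \<eta>)" .
      qed
      ultimately show ?thesis using st by simp
    qed
    ultimately have "\<bar>?A (Suc i) - ?a t\<bar> \<le> E i + K * (E i + 2 * \<eta>) * d"
      using IH(1) unfolding euler_drift_Suc by linarith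
    also have "\<dots> = E (Suc i)" by (simp add: E_def algebra_simps)
    finally have A: "\<bar>?A (Suc i) - ?a t\<bar> \<le> E (Suc i)" .
    have y: "\<bar>(f t + ?A (Suc i)) - free_path t\<bar> \<le> E (Suc i)"
      using A by (simp add: free_path_def)
    have new: "?L (Suc i) = max (?L i) (- (f t + ?A (Suc i)))"
      by (simp add: euler_local_Suc t_def)
    have "?L i \<le> L t + E (Suc i) + \<eta>"
      using IH(2) local_mono[of s t] st E_mono[of i] by linarith
    moreover have "- (f t + ?A (Suc i)) \<le> L t + E (Suc i) + \<eta>"
      using y reflected_nonneg[of t] st \<eta> by linarith
    ultimately have upper: "?L (Suc i) \<le> L t + E (Suc i) + \<eta>"
      unfolding new by simp
    have lower: "L t \<le> ?L (Suc i) + E (Suc i) + \<eta>"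
      using local_touches_boundary[OF st(1,2)]
    proof
      assume "L t = L s"
      then show ?thesis using IH(2) E_mono[of i] unfolding new by linarith
    next
      assume "\<exists>u\<in>{s..t}. L t = - free_path u"
      then obtain u where u: "u \<in> {s..t}" "L t = - free_path u" by blast
      then have "\<bar>free_path u - free_path t\<bar> \<le> \<eta>" using osc[of u t] st by auto
      then show ?thesis using u y unfolding new by linarith
    qed
    show ?case using A upper lower unfolding t_def by auto
  qed
  have "(1 + d * K) ^ i \<le> exp (d * K) ^ i"
    using d K by (intro power_mono) auto
  also have "\<dots> = exp (K * (d * real i))"
    by (simp add: exp_of_nat_mult[symmetric] algebra_simps)
  also have "\<dots> \<le> exp (K * S)" using K i by (auto intro: mult_left_mono)
  finally have "2 * \<eta> * (1 + d * K) ^ i \<le> 2 * \<eta> * exp (K * S)"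
    using \<eta> by (intro mult_left_mono) auto
  then have "E i + \<eta> \<le> 2 * \<eta> * exp (K * S)" using \<eta> by (simp add: E_def algebra_simps)
  with track[OF i] show ?thesis by linarith
qed

text \<open>
  Above the level \<open>c\<close> the scheme and \<open>L\<close> may follow different drifts, but the scheme is monotone in time:
  once it has come close to \<open>c\<close> together with \<open>L\<close>, it stays above. Hence the limit of the truncated
  values.
\<close>

lemma euler_converges:
  fixes K c T :: real
  assumes T: "0 < T" and c: "0 \<le> c" and lip: "\<And>x y. \<bar>m x - m y\<bar> \<le> K * \<bar>x - y\<bar>"
    and agree: "\<And>x. 0 \<le> x \<Longrightarrow> x \<le> c \<Longrightarrow> m x = \<mu> x"
  shows "(\<lambda>k. min (euler_local m (T / real (Suc k)) (\<lambda>i. f (T / real (Suc k) * real i)) (Suc k)) c)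
     \<longlonglongrightarrow> min (L T) c"
proof (rule LIMSEQ_I)
  fix e :: real assume e: "0 < e"
  have K: "0 \<le> K" using lip[of 0 1] by simp
  \<comment> \<open>With this oscillation bound the tracking error is at most \<open>e / 2\<close>.\<close>
  define \<eta> where "\<eta> = e / (4 * exp (K * T))"
  have \<eta>: "0 < \<eta>" "2 * \<eta> * exp (K * T) = e / 2" using e by (auto simp: \<eta>_def)
  have "1 \<le> exp (K * T)" using K T by simp
  then have "\<eta> * 1 \<le> \<eta> * exp (K * T)" using \<eta> by (intro mult_left_mono) auto
  then have \<eta>e: "\<eta> < e / 2" using \<eta> e by linarith
  have "uniformly_continuous_on {0..T} L"
    by (rule compact_uniformly_continuous[OF continuous_on_subset[OF cont_local]]) auto
  from uniformly_continuous_onE[OF this \<eta>(1)] obtain \<delta>1 where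
    \<delta>1: "0 < \<delta>1" "\<And>s t. s \<in> {0..T} \<Longrightarrow> t \<in> {0..T} \<Longrightarrow> dist t s < \<delta>1 \<Longrightarrow> dist (L t) (L s) < \<eta>"
    by metis
  have "uniformly_continuous_on {0..T} free_path"
    by (rule compact_uniformly_continuous[OF cont_free_path]) auto
  from uniformly_continuous_onE[OF this \<eta>(1)] obtain \<delta>2 where
    \<delta>2: "0 < \<delta>2" "\<And>s t. s \<in> {0..T} \<Longrightarrow> t \<in> {0..T} \<Longrightarrow> dist t s < \<delta>2 \<Longrightarrow> dist (free_path t) (free_path s) < \<eta>"
    by metis
  have "(\<lambda>k. T / real (Suc k)) \<longlonglongrightarrow> 0"
    by (rule LIMSEQ_Suc[OF lim_const_over_n])
  then have "\<forall>\<^sub>F k in sequentially. T / real (Suc k) < min \<delta>1 \<delta>2"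
    by (rule order_tendstoD) (use \<delta>1 \<delta>2 in auto)
  then obtain k0 where k0: "\<And>k. k0 \<le> k \<Longrightarrow> T / real (Suc k) < min \<delta>1 \<delta>2"
    unfolding eventually_sequentially by blast
  show "\<exists>k0. \<forall>k\<ge>k0. norm (min (euler_local m (T / real (Suc k)) (\<lambda>i. f (T / real (Suc k) * real i)) (Suc k)) c
      - min (L T) c) < e"
  proof (intro exI[of _ k0] allI impI)
    fix k assume k: "k0 \<le> k"
    define d where "d = T / real (Suc k)"
    have d: "0 < d" "d * real (Suc k) = T" "d < \<delta>1" "d < \<delta>2"
      using T k0[OF k] by (auto simp: d_def simp del: of_nat_Suc)
    let ?l = "euler_local m d (\<lambda>i. f (d * real i))"
    have track: "\<bar>?l i - L (d * real i)\<bar> \<le> e / 2"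
      if "0 \<le> S" "S \<le> T" "L S \<le> c" "d * real i \<le> S" for S i
    proof -
      have "\<bar>?l i - L (d * real i)\<bar> \<le> 2 * \<eta> * exp (K * S)"
      proof (rule euler_tracks_local[OF d(1) lip agree that(1) that(3) _ that(4)])
        fix s t assume "0 \<le> s" "s \<le> t" "t \<le> S" "t - s \<le> d"
        then show "\<bar>L s - L t\<bar> \<le> \<eta> \<and> \<bar>free_path s - free_path t\<bar> \<le> \<eta>"
          using \<delta>1(2)[of t s] \<delta>2(2)[of t s] d that by (auto simp: dist_real_def)
      qed
      also have "\<dots> \<le> 2 * \<eta> * exp (K * T)"
        using that K \<eta> by (auto intro!: mult_left_mono)
      finally show ?thesis using \<eta> by simp
    qed
    have "\<bar>min (?l (Suc k)) c - min (L T) c\<bar> < e"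
    proof (cases "L T \<le> c")
      case True
      have "\<bar>?l (Suc k) - L T\<bar> \<le> e / 2"
        using track[of T "Suc k"] True T d by simp
      then show ?thesis using e by linarith
    next
      case False
      \<comment> \<open>The scheme is compared with \<open>L\<close> at the last grid point before \<open>L\<close> reaches \<open>c\<close>.\<close>
      obtain S where S: "0 \<le> S" "S \<le> T" "L S = c"
        using IVT'[of L 0 c T] False c T local_0 continuous_on_subset[OF cont_local, of "{0..T}"] by auto
      define i where "i = nat \<lfloor>S / d\<rfloor>"
      have i_eq: "real i = of_int \<lfloor>S / d\<rfloor>" using S d by (simp add: i_def)
      have "real i \<le> S / d" "S / d < real i + 1" unfolding i_eq by linarith+
      then have i: "d * real i \<le> S" "S - d * real i < d"
        using d by (auto simp: field_simps)
      have "d * real i \<le> d * real (Suc k)" using i S d by linarith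
      then have "i \<le> Suc k" using d(1) by (simp only: mult_le_cancel_left_pos of_nat_le_iff)
      then have "?l i \<le> ?l (Suc k)" by (rule euler_local_mono)
      moreover have "\<bar>?l i - L (d * real i)\<bar> \<le> e / 2" using track[of S i] S i by simp
      moreover have "\<bar>L S - L (d * real i)\<bar> < \<eta>"
        using \<delta>1(2)[of "d * real i" S] i S d by (auto simp: dist_real_def)
      ultimately have "c - e < ?l (Suc k)" using S \<eta>e by linarith
      then show ?thesis using False e by auto
    qed
    then show "norm (min (euler_local m (T / real (Suc k)) (\<lambda>i. f (T / real (Suc k) * real i)) (Suc k)) c
      - min (L T) c) < e"
      by (simp add: d_def)
  qed
qed

lemma hitting_time_eq_infinity: "hitting_time L s = \<infinity> \<longleftrightarrow> (\<forall>t\<ge>0. L t \<noteq> s)"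
proof
  assume inf: "hitting_time L s = \<infinity>"
  show "\<forall>t\<ge>0. L t \<noteq> s"
  proof (intro allI impI notI)
    fix t assume "0 \<le> t" "L t = s"
    then have "hitting_time L s \<le> ereal t" unfolding hitting_time_def by (intro Inf_lower) auto
    then show False using inf by simp
  qed
next
  assume "\<forall>t\<ge>0. L t \<noteq> s"
  then have empty: "{t. 0 \<le> t \<and> L t = s} = {}" by blast
  show "hitting_time L s = \<infinity>"
    unfolding hitting_time_def empty by (simp add: top_ereal_def)
qed

lemma less_tau_inf_if_reached:
  assumes T: "0 \<le> T" and c: "\<tau> < c" "c \<le> L T"
  shows "ereal \<tau> < tau_inf L"
proof -
  have "ereal c \<le> tau_inf L"
    unfolding tau_inf_def
  proof (rule Inf_greatest)
    fix y assume "y \<in> ereal ` {s. 0 \<le> s \<and> hitting_time L s = \<infinity>}"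
    then obtain s where s: "y = ereal s" "0 \<le> s" "\<forall>t\<ge>0. L t \<noteq> s"
      by (auto simp: hitting_time_eq_infinity)
    have "c \<le> s"
    proof (rule ccontr)
      assume "\<not> c \<le> s"
      then have "\<exists>t\<ge>0. t \<le> T \<and> L t = s"
        using s c T local_0 continuous_on_subset[OF cont_local, of "{0..T}"] by (intro IVT') auto
      then show False using s(3) by blast
    qed
    then show "ereal c \<le> y" by (simp add: s)
  qed
  then show ?thesis using c(1) by (meson less_ereal.simps(1) less_le_trans)
qed

text \<open>
  The events on the right increase with \<open>k\<close>, as the time grows and the level shrinks, so that their
  probabilities converge to that of the event on the left.
\<close>

lemma less_tau_inf_iff:
  assumes \<tau>: "0 \<le> \<tau>"
  shows "ereal \<tau> < tau_inf L \<longleftrightarrow> (\<exists>k. \<tau> + 1 / real (Suc k) \<le> L (real (Suc k)))"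
proof
  assume less: "ereal \<tau> < tau_inf L"
  show "\<exists>k. \<tau> + 1 / real (Suc k) \<le> L (real (Suc k))"
  proof (rule ccontr)
    assume "\<not> ?thesis"
    then have k: "L (real (Suc k)) < \<tau> + 1 / real (Suc k)" for k by (auto simp: not_le)
    have le: "L t \<le> \<tau>" if t: "0 \<le> t" for t
    proof (rule LIMSEQ_le_const)
      show "(\<lambda>k. \<tau> + 1 / real (Suc k)) \<longlonglongrightarrow> \<tau>"
        using tendsto_add[OF tendsto_const LIMSEQ_Suc[OF lim_const_over_n[of "1::real"]], of \<tau>] by simp
      have "L t \<le> \<tau> + 1 / real (Suc n)" if n: "nat \<lceil>t\<rceil> \<le> n" for n
      proof -
        have "t \<le> real (Suc n)" using n by linarith
        then have "L t \<le> L (real (Suc n))" using t by (intro local_mono) auto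
        then show ?thesis using k[of n] by linarith
      qed
      then show "\<exists>N. \<forall>n\<ge>N. L t \<le> \<tau> + 1 / real (Suc n)" by blast
    qed
    obtain s where s: "ereal \<tau> < ereal s" "ereal s < tau_inf L" using ereal_dense2[OF less] by blast
    have "tau_inf L \<le> ereal s"
      unfolding tau_inf_def
      by (rule Inf_lower) (use s(1) \<tau> le in \<open>force simp: hitting_time_eq_infinity\<close>)
    then show False using s(2) by simp
  qed
next
  assume "\<exists>k. \<tau> + 1 / real (Suc k) \<le> L (real (Suc k))"
  then obtain k where "\<tau> + 1 / real (Suc k) \<le> L (real (Suc k))" by blast
  then show "ereal \<tau> < tau_inf L"
    by (intro less_tau_inf_if_reached[of "real (Suc k)" _ "\<tau> + 1 / real (Suc k)"]) auto
qed

end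

section \<open>The weights along a single path\<close>

context local_time_path begin

text \<open>
  After the level \<open>b\<close> has been passed \<open>g\<close> vanishes, so neither the reflected position nor the excess
  local time enters the weight; the assumption \<open>below\<close> makes the remaining time integral favourable.
\<close>

lemma euler_weight_on_reaching:
  fixes T C K K' b c :: real
  assumes f0: "f 0 = 0" and T: "0 < T" and b: "0 \<le> b" "b < c" and reach: "c \<le> L T"
    and m: "\<And>x. \<bar>m x\<bar> \<le> C" "\<And>x y. \<bar>m x - m y\<bar> \<le> K * \<bar>x - y\<bar>"
    and agree: "\<And>x. 0 \<le> x \<Longrightarrow> x \<le> c \<Longrightarrow> m x = \<mu> x"
    and g: "\<And>x y. \<bar>g x - g y\<bar> \<le> K' * \<bar>x - y\<bar>" "\<And>x. b \<le> x \<Longrightarrow> g x = 0"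
    and below: "\<And>x. g x * (g x - m x) \<le> 0"
  shows "\<exists>v. v \<longlonglongrightarrow> exp (2 * integral {0..b} g) \<and>
    (\<forall>\<^sub>F k in sequentially. v k \<le>
       euler_weight m g (T / real (Suc k)) (Suc k) (\<lambda>i. f (T / real (Suc k) * real i)))"
proof -
  let ?d = "\<lambda>k. T / real (Suc k)"
  let ?w = "\<lambda>k i. f (?d k * real i)"
  let ?l = "\<lambda>k. euler_local m (?d k) (?w k) (Suc k)"
  let ?v = "\<lambda>k. exp (2 * euler_clock m g (?d k) (Suc k) (?w k))"
  have g_int: "g integrable_on {x..y}" for x y
    by (rule lipschitz_imp_integrable_on[OF g(1)])
  have "(\<lambda>k. min (?l k) c) \<longlonglongrightarrow> min (L T) c"
    using b by (intro euler_converges[OF T _ m(2) agree]) auto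
  moreover have "b < min (L T) c" using b reach by simp
  ultimately have "\<forall>\<^sub>F k in sequentially. b < min (?l k) c" by (rule order_tendstoD)
  then have past: "\<forall>\<^sub>F k in sequentially. b \<le> ?l k" by eventually_elim auto
  have "(\<lambda>k. euler_clock m g (?d k) (Suc k) (?w k) - integral {0..?l k} g) \<longlonglongrightarrow> 0"
    by (rule euler_clock_tendsto[where f = f, OF T _ f0 m(1) g(1)], rule continuous_on_subset[OF cont_path]) auto
  moreover have "\<forall>\<^sub>F k in sequentially. euler_clock m g (?d k) (Suc k) (?w k) - integral {0..?l k} g
      = euler_clock m g (?d k) (Suc k) (?w k) - integral {0..b} g"
    using past
  proof eventually_elim
    case (elim k)
    show ?case by (simp only: integral_vanishing_tail[OF g_int b(1) elim g(2)])
  qed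
  ultimately have "(\<lambda>k. euler_clock m g (?d k) (Suc k) (?w k) - integral {0..b} g) \<longlonglongrightarrow> 0"
    by (rule Lim_transform_eventually)
  then have "(\<lambda>k. euler_clock m g (?d k) (Suc k) (?w k)) \<longlonglongrightarrow> integral {0..b} g"
    by (rule LIM_zero_cancel)
  then have "?v \<longlonglongrightarrow> exp (2 * integral {0..b} g)"
    by (intro tendsto_intros)
  moreover have "\<forall>\<^sub>F k in sequentially. ?v k \<le> euler_weight m g (?d k) (Suc k) (?w k)"
    using past
  proof eventually_elim
    case (elim k)
    have "(\<Sum>i<Suc k. g (euler_local m (?d k) (?w k) i) *
         (g (euler_local m (?d k) (?w k) i) - m (euler_local m (?d k) (?w k) i))) \<le> 0"
      by (rule sum_nonpos) (rule below)
    then have "?d k * (\<Sum>i<Suc k. g (euler_local m (?d k) (?w k) i) *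
         (g (euler_local m (?d k) (?w k) i) - m (euler_local m (?d k) (?w k) i))) \<le> 0"
      using T by (intro mult_nonneg_nonpos) auto
    then show ?case
      using g(2)[OF elim] by (subst euler_weight_eq) (auto simp: f0 simp del: of_nat_Suc sum.lessThan_Suc)
  qed
  ultimately show ?thesis by blast
qed

text \<open>
  As long as the level \<open>c\<close> has not been reached, the time integral in the exponent grows at rate at
  least \<open>\<epsilon>\<^sup>2\<close> and discounts the weight.
\<close>

lemma euler_weight_eventually_le:
  fixes T C K K' b c \<epsilon> :: real
  assumes f0: "f 0 = 0" and T: "0 < T" and b: "0 \<le> c" "c \<le> b"
    and m: "\<And>x. \<bar>m x\<bar> \<le> C" "\<And>x y. \<bar>m x - m y\<bar> \<le> K * \<bar>x - y\<bar>"
    and agree: "\<And>x. 0 \<le> x \<Longrightarrow> x \<le> c \<Longrightarrow> m x = \<mu> x"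
    and g: "\<And>x y. \<bar>g x - g y\<bar> \<le> K' * \<bar>x - y\<bar>" "\<And>x. b \<le> x \<Longrightarrow> g x = 0" "\<And>x. 0 \<le> g x"
    and above: "\<And>x. 0 \<le> g x * (g x - m x)"
    and strictly_above: "\<And>x. x \<le> c \<Longrightarrow> \<epsilon>\<^sup>2 \<le> g x * (g x - m x)"
    and e: "0 < e"
  shows "\<forall>\<^sub>F k in sequentially.
      euler_weight m g (T / real (Suc k)) (Suc k) (\<lambda>i. f (T / real (Suc k) * real i))
      \<le> exp (2 * integral {0..b} g) * (if c \<le> L T then 1 else exp (- 2 * \<epsilon>\<^sup>2 * T)) + e"
proof -
  let ?d = "\<lambda>k. T / real (Suc k)"
  let ?w = "\<lambda>k i. f (?d k * real i)"
  let ?l = "\<lambda>k. euler_local m (?d k) (?w k)"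
  let ?q = "if c \<le> L T then 0 else 2 * \<epsilon>\<^sup>2 * T"
  let ?r = "\<lambda>k. euler_clock m g (?d k) (Suc k) (?w k) - integral {0..?l k (Suc k)} g"
  have g_int: "g integrable_on {x..y}" for x y
    by (rule lipschitz_imp_integrable_on[OF g(1)])
  have clock_le: "integral {0..x} g \<le> integral {0..b} g" if "0 \<le> x" for x
  proof (cases "b \<le> x")
    case True
    then show ?thesis using integral_vanishing_tail[OF g_int _ True g(2)] b by simp
  next
    case False
    then show ?thesis by (intro integral_subset_le g_int) (use g(3) in auto)
  qed
  have r: "?r \<longlonglongrightarrow> 0"
    by (rule euler_clock_tendsto[where f = f, OF T _ f0 m(1) g(1)], rule continuous_on_subset[OF cont_path]) auto
  have discount: "\<forall>\<^sub>F k in sequentially.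
      ?q \<le> 2 * (?d k * (\<Sum>i<Suc k. g (?l k i) * (g (?l k i) - m (?l k i))))"
  proof (cases "c \<le> L T")
    case True
    have "0 \<le> 2 * (?d k * (\<Sum>i<Suc k. g (?l k i) * (g (?l k i) - m (?l k i))))" for k
      by (rule mult_nonneg_nonneg, simp, rule mult_nonneg_nonneg, use T in simp, rule sum_nonneg, rule above)
    then show ?thesis unfolding if_P[OF True] by (intro always_eventually allI)
  next
    case False
    have "(\<lambda>k. min (?l k (Suc k)) c) \<longlonglongrightarrow> min (L T) c"
      using b by (intro euler_converges[OF T _ m(2) agree]) auto
    moreover have "min (L T) c < c" using False by simp
    ultimately have "\<forall>\<^sub>F k in sequentially. min (?l k (Suc k)) c < c" by (rule order_tendstoD)
    then show ?thesis
    proof eventually_elim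
      case (elim k)
      have "\<epsilon>\<^sup>2 \<le> g (?l k i) * (g (?l k i) - m (?l k i))" if "i < Suc k" for i
      proof (rule strictly_above)
        have "?l k i \<le> ?l k (Suc k)" using that by (intro euler_local_mono) simp
        then show "?l k i \<le> c" using elim by simp
      qed
      then have "(\<Sum>i<Suc k. \<epsilon>\<^sup>2) \<le> (\<Sum>i<Suc k. g (?l k i) * (g (?l k i) - m (?l k i)))"
        by (intro sum_mono) simp
      then have "?d k * (\<Sum>i<Suc k. \<epsilon>\<^sup>2) \<le> ?d k * (\<Sum>i<Suc k. g (?l k i) * (g (?l k i) - m (?l k i)))"
        using T by (intro mult_left_mono) auto
      moreover have "?d k * (\<Sum>i<Suc k. \<epsilon>\<^sup>2) = \<epsilon>\<^sup>2 * T"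
        by (simp del: sum.lessThan_Suc)
      ultimately show ?case unfolding if_not_P[OF False] by linarith
    qed
  qed
  let ?U = "exp (2 * integral {0..b} g - ?q)"
  have "(\<lambda>k. ?U * exp (2 * ?r k)) \<longlonglongrightarrow> ?U * exp (2 * 0)"
    by (intro tendsto_intros r)
  then have "\<forall>\<^sub>F k in sequentially. ?U * exp (2 * ?r k) < ?U + e"
    by (rule order_tendstoD) (use e in simp)
  then have "\<forall>\<^sub>F k in sequentially. euler_weight m g (?d k) (Suc k) (?w k) \<le> ?U + e"
    using discount
  proof eventually_elim
    case (elim k)
    have arith: "2 * C - 2 * x - 2 * s \<le> (2 * I - q) + 2 * (C - J)"
      if "0 \<le> x" "J \<le> I" "q \<le> 2 * s" for C x s I q J :: real
      using that by simp
    let ?s = "?d k * (\<Sum>i<Suc k. g (?l k i) * (g (?l k i) - m (?l k i)))"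
    let ?x = "g (?l k (Suc k)) * (?w k (Suc k) + euler_drift m (?d k) (?w k) (Suc k) + ?l k (Suc k))"
    have "0 \<le> ?x"
      by (intro mult_nonneg_nonneg g(3) euler_reflected_nonneg[where w = "?w k"]) (simp add: f0)
    moreover have "integral {0..?l k (Suc k)} g \<le> integral {0..b} g"
      by (intro clock_le euler_local_nonneg)
    ultimately have "2 * euler_clock m g (?d k) (Suc k) (?w k) - 2 * ?x - 2 * ?s
        \<le> (2 * integral {0..b} g - ?q) + 2 * ?r k"
      using elim(2) by (rule arith)
    then have "exp (2 * euler_clock m g (?d k) (Suc k) (?w k) - 2 * ?x - 2 * ?s) \<le> ?U * exp (2 * ?r k)"
      by (simp only: exp_add[symmetric] exp_le_cancel_iff)
    moreover have "euler_weight m g (?d k) (Suc k) (?w k)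
        = exp (2 * euler_clock m g (?d k) (Suc k) (?w k) - 2 * ?x - 2 * ?s)"
      by (subst euler_weight_eq) (simp_all add: f0 mult.assoc del: of_nat_Suc sum.lessThan_Suc)
    ultimately show ?case using elim(1) by linarith
  qed
  moreover have "?U = exp (2 * integral {0..b} g) * (if c \<le> L T then 1 else exp (- 2 * \<epsilon>\<^sup>2 * T))"
    by (simp add: exp_diff exp_minus field_simps)
  ultimately show ?thesis by simp
qed

end

section \<open>Limits of random weights\<close>

text \<open>
  Markov's inequality for the lower limit of the weights, whose integral Fatou's lemma bounds by 1.
\<close>

lemma (in prob_space) prob_le_if_liminf_ge:
  fixes W :: "nat \<Rightarrow> 'a \<Rightarrow> real"
  assumes int: "\<And>k. integrable M (W k)" and one: "\<And>k. expectation (W k) = 1"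
    and nonneg: "\<And>k \<omega>. 0 \<le> W k \<omega>"
    and A: "A \<in> events" and c: "0 < c"
    and lim: "\<And>\<omega>. \<omega> \<in> A \<Longrightarrow> \<exists>v. v \<longlonglongrightarrow> c \<and> (\<forall>\<^sub>F k in sequentially. v k \<le> W k \<omega>)"
  shows "prob A \<le> 1 / c"
proof -
  have "ennreal c * indicator A \<omega> \<le> liminf (\<lambda>k. ennreal (W k \<omega>))" for \<omega>
  proof (cases "\<omega> \<in> A")
    case True
    from lim[OF this] obtain v where v: "v \<longlonglongrightarrow> c" "\<forall>\<^sub>F k in sequentially. v k \<le> W k \<omega>" by blast
    have "(\<lambda>k. ennreal (v k)) \<longlonglongrightarrow> ennreal c" by (intro tendsto_ennrealI v)
    then have "ennreal c = liminf (\<lambda>k. ennreal (v k))"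
      by (simp add: lim_imp_Liminf)
    also have "\<dots> \<le> liminf (\<lambda>k. ennreal (W k \<omega>))"
      by (rule Liminf_mono) (use v(2) in eventually_elim, auto intro: ennreal_leI)
    finally show ?thesis using True by simp
  qed simp
  then have "(\<integral>\<^sup>+ \<omega>. ennreal c * indicator A \<omega> \<partial>M) \<le> (\<integral>\<^sup>+ \<omega>. liminf (\<lambda>k. ennreal (W k \<omega>)) \<partial>M)"
    by (intro nn_integral_mono)
  also have "\<dots> \<le> liminf (\<lambda>k. \<integral>\<^sup>+ \<omega>. ennreal (W k \<omega>) \<partial>M)"
    by (rule nn_integral_liminf) (use int in auto)
  also have "\<dots> = 1"
    using int one nonneg by (simp add: nn_integral_eq_integral Liminf_const)
  finally have "ennreal c * emeasure M A \<le> 1"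
    using A by (simp add: nn_integral_cmult_indicator)
  then have "ennreal (c * prob A) \<le> ennreal 1"
    using c by (simp add: emeasure_eq_measure ennreal_mult'')
  then have "c * prob A \<le> 1" by (subst (asm) ennreal_le_iff) auto
  then show ?thesis using c by (simp add: field_simps)
qed

text \<open>
  The second moments prevent mass from escaping in the limit: \<open>W k \<le> min (W k) K + (W k)\<^sup>2 / K\<close>, and
  the truncated weights converge after being raised to at least \<open>U\<close>.
\<close>

lemma (in prob_space) expectation_ge_if_limsup_le:
  fixes W :: "nat \<Rightarrow> 'a \<Rightarrow> real"
  assumes int: "\<And>k. integrable M (W k)" and one: "\<And>k. expectation (W k) = 1"
    and nonneg: "\<And>k \<omega>. 0 \<le> W k \<omega>"
    and int2: "\<And>k. integrable M (\<lambda>\<omega>. (W k \<omega>)\<^sup>2)" and second: "\<And>k. expectation (\<lambda>\<omega>. (W k \<omega>)\<^sup>2) \<le> D"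
    and U: "integrable M U" and U0: "\<And>\<omega>. 0 \<le> U \<omega>"
    and lim: "\<And>\<omega> e. \<omega> \<in> space M \<Longrightarrow> 0 < e \<Longrightarrow> \<forall>\<^sub>F k in sequentially. W k \<omega> \<le> U \<omega> + e"
  shows "1 \<le> expectation U"
proof -
  have bound: "1 \<le> expectation U + D / K" if K: "0 < K" for K
  proof -
    define V where "V k \<omega> = max (min (W k \<omega>) K) (U \<omega>)" for k \<omega>
    have [measurable]: "U \<in> borel_measurable M" "W k \<in> borel_measurable M" for k
      using U int by auto
    have Vm [measurable]: "V k \<in> borel_measurable M" for k unfolding V_def by measurable
    have Vb: "norm (V k \<omega>) \<le> K + U \<omega>" for k \<omega>
      using K U0[of \<omega>] nonneg[of k \<omega>] by (auto simp: V_def)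
    have KU: "integrable M (\<lambda>\<omega>. K + U \<omega>)" using U by simp
    have Vint: "integrable M (V k)" for k
      by (rule Bochner_Integration.integrable_bound[OF KU Vm])
        (use Vb in \<open>auto intro: order_trans[OF _ abs_ge_self]\<close>)
    have "(\<lambda>k. expectation (V k)) \<longlonglongrightarrow> expectation U"
    proof (rule integral_dominated_convergence[OF _ Vm KU])
      show "AE \<omega> in M. (\<lambda>k. V k \<omega>) \<longlonglongrightarrow> U \<omega>"
      proof (rule AE_I2, rule LIMSEQ_I)
        fix \<omega> e assume "\<omega> \<in> space M" "0 < (e::real)"
        then have "\<forall>\<^sub>F k in sequentially. W k \<omega> \<le> U \<omega> + e / 2" by (intro lim) auto
        then have "\<forall>\<^sub>F k in sequentially. norm (V k \<omega> - U \<omega>) < e"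
          by eventually_elim (use \<open>0 < e\<close> in \<open>auto simp: V_def\<close>)
        then show "\<exists>n0. \<forall>n\<ge>n0. norm (V n \<omega> - U \<omega>) < e" by (simp add: eventually_sequentially)
      qed
    qed (use Vb in auto)
    moreover have "1 \<le> expectation (V k) + D / K" for k
    proof -
      have "W k \<omega> \<le> V k \<omega> + (W k \<omega>)\<^sup>2 / K" for \<omega>
      proof (cases "W k \<omega> \<le> K")
        case True
        then have "W k \<omega> \<le> V k \<omega>" by (simp add: V_def)
        moreover have "0 \<le> (W k \<omega>)\<^sup>2 / K" using K by simp
        ultimately show ?thesis by linarith
      next
        case False
        then have "W k \<omega> * K \<le> (W k \<omega>)\<^sup>2"
          using nonneg[of k \<omega>] by (simp add: power2_eq_square mult_left_mono)
        then have "W k \<omega> \<le> (W k \<omega>)\<^sup>2 / K" using K by (simp add: field_simps)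
        moreover have "0 \<le> V k \<omega>" using U0[of \<omega>] by (simp add: V_def)
        ultimately show ?thesis by linarith
      qed
      then have "expectation (W k) \<le> expectation (\<lambda>\<omega>. V k \<omega> + (W k \<omega>)\<^sup>2 / K)"
        using int Vint int2 by (intro integral_mono) auto
      also have "\<dots> = expectation (V k) + expectation (\<lambda>\<omega>. (W k \<omega>)\<^sup>2) / K"
        using Vint int2 by simp
      also have "\<dots> \<le> expectation (V k) + D / K"
        using second K by (simp add: divide_right_mono)
      finally show ?thesis by (simp add: one)
    qed
    ultimately show ?thesis
      by (intro LIMSEQ_le_const[of "\<lambda>k. expectation (V k) + D / K"]) (auto intro!: tendsto_intros)
  qed
  have "(\<lambda>k. expectation U + D / real (Suc k)) \<longlonglongrightarrow> expectation U + 0"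
    by (intro tendsto_intros LIMSEQ_Suc[OF lim_const_over_n])
  then show ?thesis
    using bound by (intro LIMSEQ_le_const[of "\<lambda>k. expectation U + D / real (Suc k)"]) auto
qed

section \<open>The probability of reaching a level\<close>

text \<open>
  The drift is only locally Lipschitz, but as long as the local time stays below \<open>r\<close> the process
  does not see the values of \<open>\<mu>\<close> beyond \<open>r\<close>.
\<close>

lemma admissible_drift_clamped:
  assumes adm: "admissible_drift \<mu>" and r: "0 \<le> r"
  obtains K C where "\<And>x y. \<bar>\<mu> (max 0 (min x r)) - \<mu> (max 0 (min y r))\<bar> \<le> K * \<bar>x - y\<bar>"
    and "\<And>x. \<bar>\<mu> (max 0 (min x r))\<bar> \<le> C"
proof -
  have "\<forall>l. bdd_above {\<bar>\<mu> b - \<mu> a\<bar> / (b - a) | a b. 0 \<le> a \<and> a < b \<and> b < l}"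
    using adm unfolding admissible_drift_def by (elim conjE)
  then have "bdd_above {\<bar>\<mu> b - \<mu> a\<bar> / (b - a) | a b. 0 \<le> a \<and> a < b \<and> b < r + 1}"
    by (rule spec)
  then obtain K0 where K0: "\<And>a b. 0 \<le> a \<Longrightarrow> a < b \<Longrightarrow> b < r + 1 \<Longrightarrow> \<bar>\<mu> b - \<mu> a\<bar> / (b - a) \<le> K0"
    unfolding bdd_above_def by blast
  define K where "K = max K0 0"
  have ordered: "\<bar>\<mu> b - \<mu> a\<bar> \<le> K * (b - a)" if "0 \<le> a" "a \<le> b" "b \<le> r" for a b
  proof (cases "a = b")
    case False
    then have "\<bar>\<mu> b - \<mu> a\<bar> / (b - a) \<le> K" using K0[of a b] that by (simp add: K_def le_max_iff_disj)
    then show ?thesis using False that by (simp add: pos_divide_le_eq)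
  qed simp
  have lip: "\<bar>\<mu> (max 0 (min x r)) - \<mu> (max 0 (min y r))\<bar> \<le> K * \<bar>x - y\<bar>" for x y
  proof (induction x y rule: linorder_wlog)
    case (le x y)
    have "\<bar>\<mu> (max 0 (min y r)) - \<mu> (max 0 (min x r))\<bar> \<le> K * (max 0 (min y r) - max 0 (min x r))"
      using le r by (intro ordered) auto
    also have "\<dots> \<le> K * \<bar>x - y\<bar>"
      using le by (intro mult_left_mono) (auto simp: K_def)
    finally show ?case by (simp add: abs_minus_commute)
  next
    case (sym x y)
    then show ?case by (simp add: abs_minus_commute)
  qed
  have bound: "\<bar>\<mu> (max 0 (min x r))\<bar> \<le> \<bar>\<mu> 0\<bar> + K * r" for x
  proof -
    have "\<bar>\<mu> (max 0 (min x r)) - \<mu> 0\<bar> \<le> K * (max 0 (min x r) - 0)"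
      using r by (intro ordered) auto
    also have "\<dots> \<le> K * r" using r by (intro mult_left_mono) (auto simp: K_def)
    finally show ?thesis by linarith
  qed
  show thesis by (rule that[OF lip bound])
qed

locale brownian_local_time = brownian_motion M B
  for M :: "'a measure" and B :: "real \<Rightarrow> 'a \<Rightarrow> real" +
  fixes \<mu> :: "real \<Rightarrow> real" and L :: "real \<Rightarrow> 'a \<Rightarrow> real"
  assumes admissible: "admissible_drift \<mu>"
    and local_time: "\<And>\<omega>. \<omega> \<in> space M \<Longrightarrow> is_local_time \<mu> (\<lambda>t. B t \<omega>) (\<lambda>t. L t \<omega>)"
begin

lemma cont_drift: "continuous_on {0..} \<mu>"
  using admissible by (simp add: admissible_drift_def)

lemma local_time_path: "\<omega> \<in> space M \<Longrightarrow> local_time_path \<mu> (\<lambda>t. B t \<omega>) (\<lambda>t. L t \<omega>)"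
  by unfold_locales (auto intro: cont_drift continuous_paths local_time)

text \<open>
  The truncated local time is a pointwise limit of the schemes, which are measurable functions of
  finitely many values of \<open>B\<close>.
\<close>

lemma reaching_measurable:
  fixes T c K :: real
  assumes T: "0 < T" and c: "0 \<le> c" and lip: "\<And>x y. \<bar>m x - m y\<bar> \<le> K * \<bar>x - y\<bar>"
    and agree: "\<And>x. 0 \<le> x \<Longrightarrow> x \<le> c \<Longrightarrow> m x = \<mu> x"
  shows "{\<omega>\<in>space M. c \<le> L T \<omega>} \<in> events"
proof -
  have m: "m \<in> borel_measurable borel" by (rule lipschitz_imp_borel_measurable[OF lip])
  let ?l = "\<lambda>k \<omega>. min (euler_local m (T / real (Suc k)) (\<lambda>i. B (T / real (Suc k) * real i) \<omega>) (Suc k)) c"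
  have [measurable]: "(\<lambda>\<omega>. min (L T \<omega>) c) \<in> borel_measurable M"
  proof (rule borel_measurable_LIMSEQ_real)
    show "(\<lambda>k. ?l k \<omega>) \<longlonglongrightarrow> min (L T \<omega>) c" if "\<omega> \<in> space M" for \<omega>
      by (rule local_time_path.euler_converges[OF local_time_path[OF that] T c lip agree])
    show "?l k \<in> borel_measurable M" for k
      using T by (intro borel_measurable_min euler_measurable[OF m] borel_measurable_const) simp
  qed
  have "{\<omega>\<in>space M. c \<le> min (L T \<omega>) c} \<in> events" by measurable
  also have "{\<omega>\<in>space M. c \<le> min (L T \<omega>) c} = {\<omega>\<in>space M. c \<le> L T \<omega>}" by auto
  finally show ?thesis .
qed

lemma prob_reaching_le:
  fixes T C G K K' b c :: real
  assumes T: "0 < T" and b: "0 \<le> b" "b < c"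
    and m: "\<And>x. \<bar>m x\<bar> \<le> C" "\<And>x y. \<bar>m x - m y\<bar> \<le> K * \<bar>x - y\<bar>"
    and agree: "\<And>x. 0 \<le> x \<Longrightarrow> x \<le> c \<Longrightarrow> m x = \<mu> x"
    and g: "\<And>x. \<bar>g x\<bar> \<le> G" "\<And>x y. \<bar>g x - g y\<bar> \<le> K' * \<bar>x - y\<bar>" "\<And>x. b \<le> x \<Longrightarrow> g x = 0"
    and below: "\<And>x. g x * (g x - m x) \<le> 0"
  shows "prob {\<omega>\<in>space M. c \<le> L T \<omega>} \<le> exp (- 2 * integral {0..b} g)"
proof -
  have mm: "m \<in> borel_measurable borel" and gm: "g \<in> borel_measurable borel"
    by (rule lipschitz_imp_borel_measurable, rule m, rule lipschitz_imp_borel_measurable, rule g)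
  let ?W = "\<lambda>k \<omega>. euler_weight m g (T / real (Suc k)) (Suc k) (\<lambda>i. B (T / real (Suc k) * real i) \<omega>)"
  have d: "0 < T / real (Suc k)" for k using T by simp
  have "prob {\<omega>\<in>space M. c \<le> L T \<omega>} \<le> 1 / exp (2 * integral {0..b} g)"
  proof (rule prob_le_if_liminf_ge[where W = ?W])
    show "integrable M (?W k)" "expectation (?W k) = 1" for k
      by (rule euler_weight_moments[OF mm gm g(1) d])+
    show "0 \<le> ?W k \<omega>" for k \<omega> by (simp add: euler_weight_def)
    show "{\<omega>\<in>space M. c \<le> L T \<omega>} \<in> events"
      using b by (intro reaching_measurable[OF T _ m(2) agree]) auto
    show "\<exists>v. v \<longlonglongrightarrow> exp (2 * integral {0..b} g) \<and> (\<forall>\<^sub>F k in sequentially. v k \<le> ?W k \<omega>)"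
      if "\<omega> \<in> {\<omega>\<in>space M. c \<le> L T \<omega>}" for \<omega>
      using that
      by (intro local_time_path.euler_weight_on_reaching[OF local_time_path _ T b _ m agree g(2,3) below])
        (auto simp: start)
  qed simp
  then show ?thesis by (simp add: exp_minus field_simps)
qed

lemma one_le_prob_reaching:
  fixes T C G K K' b c \<epsilon> :: real
  assumes T: "0 < T" and b: "0 \<le> c" "c \<le> b"
    and m: "\<And>x. \<bar>m x\<bar> \<le> C" "\<And>x y. \<bar>m x - m y\<bar> \<le> K * \<bar>x - y\<bar>"
    and agree: "\<And>x. 0 \<le> x \<Longrightarrow> x \<le> c \<Longrightarrow> m x = \<mu> x"
    and g: "\<And>x. \<bar>g x\<bar> \<le> G" "\<And>x y. \<bar>g x - g y\<bar> \<le> K' * \<bar>x - y\<bar>" "\<And>x. b \<le> x \<Longrightarrow> g x = 0" "\<And>x. 0 \<le> g x"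
    and above: "\<And>x. 0 \<le> g x * (g x - m x)"
    and strictly_above: "\<And>x. x \<le> c \<Longrightarrow> \<epsilon>\<^sup>2 \<le> g x * (g x - m x)"
  shows "1 \<le> exp (2 * integral {0..b} g) * (prob {\<omega>\<in>space M. c \<le> L T \<omega>} + exp (- 2 * \<epsilon>\<^sup>2 * T))"
proof -
  have mm: "m \<in> borel_measurable borel" and gm: "g \<in> borel_measurable borel"
    by (rule lipschitz_imp_borel_measurable, rule m, rule lipschitz_imp_borel_measurable, rule g)
  let ?W = "\<lambda>k \<omega>. euler_weight m g (T / real (Suc k)) (Suc k) (\<lambda>i. B (T / real (Suc k) * real i) \<omega>)"
  define A where "A = {\<omega>\<in>space M. c \<le> L T \<omega>}"
  let ?U = "\<lambda>\<omega>. exp (2 * integral {0..b} g) * (indicator A \<omega> + exp (- 2 * \<epsilon>\<^sup>2 * T))"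
  have d: "0 < T / real (Suc k)" "T / real (Suc k) * real (Suc k) = T" for k
    using T by (auto simp del: of_nat_Suc)
  have A: "A \<in> events" unfolding A_def by (rule reaching_measurable[OF T b(1) m(2) agree])
  have A_int: "integrable M (\<lambda>\<omega>. indicator A \<omega> :: real)"
    using A by (intro integrable_real_indicator) (auto simp: less_top[symmetric])
  have int: "integrable M ?U"
    by (intro Bochner_Integration.integrable_mult_right Bochner_Integration.integrable_add A_int integrable_const)
  have "1 \<le> expectation ?U"
  proof (rule expectation_ge_if_limsup_le[where W = ?W and D = "exp (4 * G\<^sup>2 * T)"])
    show "integrable M (?W k)" "expectation (?W k) = 1" "integrable M (\<lambda>\<omega>. (?W k \<omega>)\<^sup>2)" for k
      by (rule euler_weight_moments[OF mm gm g(1) d(1)])+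
    show "expectation (\<lambda>\<omega>. (?W k \<omega>)\<^sup>2) \<le> exp (4 * G\<^sup>2 * T)" for k
      using euler_weight_moments(4)[OF mm gm g(1) d(1), of k "Suc k"] unfolding d(2) .
    show "0 \<le> ?W k \<omega>" for k \<omega> by (simp add: euler_weight_def)
    show "integrable M ?U" by (rule int)
    show "0 \<le> ?U \<omega>" for \<omega> by simp
    show "\<forall>\<^sub>F k in sequentially. ?W k \<omega> \<le> ?U \<omega> + e" if \<omega>: "\<omega> \<in> space M" and e: "0 < e" for \<omega> e
    proof -
      have "\<forall>\<^sub>F k in sequentially. ?W k \<omega> \<le> exp (2 * integral {0..b} g) *
          (if c \<le> L T \<omega> then 1 else exp (- 2 * \<epsilon>\<^sup>2 * T)) + e"
        by (rule local_time_path.euler_weight_eventually_le[OF local_time_path[OF \<omega>] _ T b m agree g(2-4)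
              above strictly_above e]) (simp add: start \<omega>)
      moreover have "exp (2 * integral {0..b} g) * (if c \<le> L T \<omega> then 1 else exp (- 2 * \<epsilon>\<^sup>2 * T)) \<le> ?U \<omega>"
        using \<omega> by (intro mult_left_mono) (auto simp: A_def indicator_def)
      ultimately show ?thesis by (elim eventually_mono) linarith
    qed
  qed
  also have "expectation ?U = exp (2 * integral {0..b} g) * (prob A + exp (- 2 * \<epsilon>\<^sup>2 * T))"
    using A A_int by (simp add: prob_space)
  finally show ?thesis unfolding A_def .
qed

lemma pos_part_integrable: "0 \<le> a \<Longrightarrow> (\<lambda>s. max (\<mu> s) 0) integrable_on {a..b}"
  by (rule integrable_continuous_real, rule continuous_on_max[OF _ continuous_on_const],
      rule continuous_on_subset[OF cont_drift]) auto

text \<open>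
  The weight is built from the positive part of \<open>\<mu>\<close>, switched off between \<open>\<tau>\<close> and a level \<open>b < c\<close>.
\<close>

lemma prob_reaching_le_exp:
  assumes T: "0 < T" and \<tau>: "0 \<le> \<tau>" "\<tau> < c"
  shows "prob {\<omega>\<in>space M. c \<le> L T \<omega>} \<le> exp (- 2 * integral {0..\<tau>} (\<lambda>s. max (\<mu> s) 0))"
proof -
  define b where "b = (\<tau> + c) / 2"
  have b: "\<tau> < b" "b < c" "0 \<le> b" "0 \<le> c" using \<tau> by (auto simp: b_def)
  let ?m = "\<lambda>x. \<mu> (max 0 (min x c))"
  let ?p = "\<lambda>x. max (?m x) 0"
  let ?g = "\<lambda>x. ?p x * ramp \<tau> b x"
  obtain K C where K: "\<And>x y. \<bar>?m x - ?m y\<bar> \<le> K * \<bar>x - y\<bar>" and C: "\<And>x. \<bar>?m x\<bar> \<le> C"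
    using admissible_drift_clamped[OF admissible b(4)] by blast
  have p_lip: "\<bar>?p x - ?p y\<bar> \<le> K * \<bar>x - y\<bar>" for x y
    using K[of x y] by (rule order_trans[rotated]) (auto simp: max_def)
  have p_bound: "\<bar>?p x\<bar> \<le> C" for x using C[of x] by (auto simp: max_def)
  have g_lip: "\<bar>?g x - ?g y\<bar> \<le> (K + C * (1 / (b - \<tau>))) * \<bar>x - y\<bar>" for x y
    by (rule lipschitz_mult_bounded[where p = ?p and q = "ramp \<tau> b", OF p_lip p_bound ramp_lipschitz[OF b(1)]])
      (use ramp_range[of \<tau> b x] in simp)
  have g_bound: "\<bar>?g x\<bar> \<le> C" for x
  proof -
    have "\<bar>?g x\<bar> \<le> C * 1"
      unfolding abs_mult using p_bound[of x] ramp_range[of \<tau> b x]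
      by (intro mult_mono) (auto intro: order_trans[OF abs_ge_zero])
    then show ?thesis by simp
  qed
  have below: "?g x * (?g x - ?m x) \<le> 0" for x
  proof (cases "?m x \<le> 0")
    case False
    then have p: "?p x = ?m x" "0 \<le> ?m x" by auto
    have "?m x * ramp \<tau> b x \<le> ?m x * 1"
      using p ramp_range[of \<tau> b x] by (intro mult_left_mono) auto
    then show ?thesis
      unfolding p using p ramp_range[of \<tau> b x] by (intro mult_nonneg_nonpos) auto
  qed simp
  have "prob {\<omega>\<in>space M. c \<le> L T \<omega>} \<le> exp (- 2 * integral {0..b} ?g)"
    by (rule prob_reaching_le[OF T b(3,2) C K _ g_bound g_lip _ below]) (use ramp_eq[OF b(1)] in auto)
  moreover have "integral {0..\<tau>} (\<lambda>s. max (\<mu> s) 0) \<le> integral {0..b} ?g"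
  proof -
    have g_int: "?g integrable_on {x..y}" for x y
      by (rule lipschitz_imp_integrable_on, rule g_lip)
    have "integral {0..\<tau>} (\<lambda>s. max (\<mu> s) 0) = integral {0..\<tau>} ?g"
      by (rule integral_cong) (use b ramp_eq[OF b(1)] in auto)
    also have "\<dots> \<le> integral {0..b} ?g"
      by (rule integral_subset_le[OF _ g_int g_int]) (use b ramp_range[of \<tau> b] in auto)
    finally show ?thesis .
  qed
  ultimately show ?thesis by (elim order_trans) simp
qed

text \<open>
  Here the drift itself is switched off between \<open>c\<close> and \<open>b\<close> together with \<open>g\<close>. A drift that
  stays positive above \<open>b\<close> cannot be dominated by a function of finite integral, and the weight would
  be unbounded.
\<close>

lemma one_le_exp_prob_reaching:
  assumes T: "0 < T" and c: "0 \<le> c" "c < b" and \<epsilon>: "0 < \<epsilon>"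
  shows "1 \<le> exp (2 * (integral {0..b} (\<lambda>s. max (\<mu> s) 0) + \<epsilon> * b)) *
    (prob {\<omega>\<in>space M. c \<le> L T \<omega>} + exp (- 2 * \<epsilon>\<^sup>2 * T))"
proof -
  have b: "0 \<le> b" using c by simp
  let ?m = "\<lambda>x. \<mu> (max 0 (min x b))"
  let ?p = "\<lambda>x. max (?m x) 0 + \<epsilon>"
  let ?r = "ramp c b"
  let ?g = "\<lambda>x. ?p x * ?r x"
  obtain K C where K: "\<And>x y. \<bar>?m x - ?m y\<bar> \<le> K * \<bar>x - y\<bar>" and C: "\<And>x. \<bar>?m x\<bar> \<le> C"
    using admissible_drift_clamped[OF admissible b] by blast
  have p_lip: "\<bar>?p x - ?p y\<bar> \<le> K * \<bar>x - y\<bar>" for x y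
    using K[of x y] by (rule order_trans[rotated]) (auto simp: max_def)
  have p_bound: "\<bar>?p x\<bar> \<le> C + \<epsilon>" for x using C[of x] \<epsilon> by (auto simp: max_def)
  have m_lip: "\<bar>?m x * ?r x - ?m y * ?r y\<bar> \<le> (K + C * (1 / (b - c))) * \<bar>x - y\<bar>" for x y
    by (rule lipschitz_mult_bounded[where p = ?m and q = ?r, OF K C ramp_lipschitz[OF c(2)]])
      (use ramp_range[of c b x] in simp)
  have g_lip: "\<bar>?g x - ?g y\<bar> \<le> (K + (C + \<epsilon>) * (1 / (b - c))) * \<bar>x - y\<bar>" for x y
    by (rule lipschitz_mult_bounded[where p = ?p and q = ?r, OF p_lip p_bound ramp_lipschitz[OF c(2)]])
      (use ramp_range[of c b x] in simp)
  have times_ramp_le: "\<bar>z * ?r x\<bar> \<le> D" if "\<bar>z\<bar> \<le> D" for z x D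
  proof -
    have "\<bar>z\<bar> * \<bar>?r x\<bar> \<le> D * 1"
      using that ramp_range[of c b x] by (intro mult_mono) (auto intro: order_trans[OF abs_ge_zero])
    then show ?thesis by (simp add: abs_mult)
  qed
  \<comment> \<open>The common factor makes \<open>g * (g - m)\<close> nonnegative also where the drift is being switched off.\<close>
  have gap: "?g x * (?g x - ?m x * ?r x) = (?r x)\<^sup>2 * (?p x * (?p x - ?m x))" for x
    by (simp add: power2_eq_square algebra_simps)
  have p_gap: "\<epsilon>\<^sup>2 \<le> ?p x * (?p x - ?m x)" for x
    unfolding power2_eq_square using \<epsilon> by (intro mult_mono) auto
  have g_int: "?g integrable_on {x..y}" for x y
    by (rule lipschitz_imp_integrable_on, rule g_lip)
  have "1 \<le> exp (2 * integral {0..b} ?g) * (prob {\<omega>\<in>space M. c \<le> L T \<omega>} + exp (- 2 * \<epsilon>\<^sup>2 * T))"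
  proof (rule one_le_prob_reaching[OF T c(1) less_imp_le[OF c(2)] _ m_lip _ _ g_lip])
    show "\<bar>?m x * ?r x\<bar> \<le> C" for x by (rule times_ramp_le[OF C])
    show "\<bar>?g x\<bar> \<le> C + \<epsilon>" for x by (rule times_ramp_le[OF p_bound])
    show "?m x * ?r x = \<mu> x" if "0 \<le> x" "x \<le> c" for x
      using that c ramp_eq(1)[OF c(2)] by simp
    show "?g x = 0" if "b \<le> x" for x using that ramp_eq(2)[OF c(2)] by simp
    show "0 \<le> ?g x" for x using \<epsilon> ramp_range[of c b x] by (intro mult_nonneg_nonneg) auto
    show "0 \<le> ?g x * (?g x - ?m x * ?r x)" for x
      unfolding gap by (rule mult_nonneg_nonneg[OF zero_le_power2 order_trans[OF zero_le_power2 p_gap]])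
    show "\<epsilon>\<^sup>2 \<le> ?g x * (?g x - ?m x * ?r x)" if "x \<le> c" for x
    proof -
      have "?g x * (?g x - ?m x * ?r x) = 1\<^sup>2 * (?p x * (?p x - ?m x))"
        unfolding gap by (simp only: ramp_eq(1)[OF c(2) that])
      then show ?thesis using p_gap[of x] by (simp only: power_one mult_1)
    qed
  qed
  also have "\<dots> \<le> exp (2 * (integral {0..b} (\<lambda>s. max (\<mu> s) 0) + \<epsilon> * b)) *
    (prob {\<omega>\<in>space M. c \<le> L T \<omega>} + exp (- 2 * \<epsilon>\<^sup>2 * T))"
  proof (rule mult_right_mono)
    have "integral {0..b} ?g \<le> integral {0..b} (\<lambda>s. max (\<mu> s) 0 + \<epsilon>)"
    proof (rule integral_le[OF g_int])
      show "(\<lambda>s. max (\<mu> s) 0 + \<epsilon>) integrable_on {0..b}"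
        by (rule Henstock_Kurzweil_Integration.integrable_add[OF pos_part_integrable]) auto
      fix x assume "x \<in> {0..b}"
      then have "?p x = max (\<mu> x) 0 + \<epsilon>" by simp
      moreover have "?g x \<le> ?p x * 1"
        using ramp_range[of c b x] \<epsilon> by (intro mult_left_mono) auto
      ultimately show "?g x \<le> max (\<mu> x) 0 + \<epsilon>" by simp
    qed
    also have "\<dots> = integral {0..b} (\<lambda>s. max (\<mu> s) 0) + \<epsilon> * b"
      using b pos_part_integrable[of 0 b]
      by (subst Henstock_Kurzweil_Integration.integral_add) auto
    finally show "exp (2 * integral {0..b} ?g) \<le> exp (2 * (integral {0..b} (\<lambda>s. max (\<mu> s) 0) + \<epsilon> * b))"
      by simp
  qed simp
  finally show ?thesis .
qed

lemma reaching_level_measurable: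
  assumes "0 < T" "0 \<le> c"
  shows "{\<omega>\<in>space M. c \<le> L T \<omega>} \<in> events"
proof -
  obtain K C where K: "\<And>x y. \<bar>\<mu> (max 0 (min x c)) - \<mu> (max 0 (min y c))\<bar> \<le> K * \<bar>x - y\<bar>"
    and "\<And>x. \<bar>\<mu> (max 0 (min x c))\<bar> \<le> C"
    using admissible_drift_clamped[OF admissible assms(2)] by blast
  show ?thesis by (rule reaching_measurable[OF assms K]) simp
qed

end

theorem theorem2p9:
  fixes M :: "'a measure" and B L :: "real \<Rightarrow> 'a \<Rightarrow> real" and \<mu> :: "real \<Rightarrow> real" and \<tau> :: real
  assumes "brownian_motion M B"
    and "admissible_drift \<mu>"
    and "\<And>\<omega>. \<omega> \<in> space M \<Longrightarrow> is_local_time \<mu> (\<lambda>t. B t \<omega>) (\<lambda>t. L t \<omega>)"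
    and "0 \<le> \<tau>"
  shows "\<P>(\<omega> in M. tau_inf (\<lambda>t. L t \<omega>) > ereal \<tau>) = exp (- 2 * (LBINT s:{0..\<tau>}. max (\<mu> s) 0))"
proof -
  interpret brownian_motion M B by fact
  interpret brownian_local_time M B \<mu> L
    by unfold_locales (fact assms)+
  let ?p = "\<lambda>s. max (\<mu> s) 0"
  let ?P = "prob {\<omega>\<in>space M. ereal \<tau> < tau_inf (\<lambda>t. L t \<omega>)}"
  define E where "E k = {\<omega>\<in>space M. \<tau> + 1 / real (Suc k) \<le> L (real (Suc k)) \<omega>}" for k
  have E: "E k \<in> events" for k
    unfolding E_def using assms(4) by (intro reaching_level_measurable) auto
  have E_Union: "{\<omega>\<in>space M. ereal \<tau> < tau_inf (\<lambda>t. L t \<omega>)} = (\<Union>k. E k)"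
    by (auto simp: E_def local_time_path.less_tau_inf_iff[OF local_time_path assms(4)] simp del: of_nat_Suc)
  have event: "{\<omega>\<in>space M. ereal \<tau> < tau_inf (\<lambda>t. L t \<omega>)} \<in> events"
    unfolding E_Union using E by auto
  have E_inc: "incseq E"
  proof (rule incseq_SucI, rule subsetI)
    fix k \<omega> assume "\<omega> \<in> E k"
    then have \<omega>: "\<omega> \<in> space M" "\<tau> + 1 / real (Suc k) \<le> L (real (Suc k)) \<omega>" by (auto simp: E_def)
    have "1 / real (Suc (Suc k)) \<le> 1 / real (Suc k)" by (simp add: field_simps)
    moreover have "L (real (Suc k)) \<omega> \<le> L (real (Suc (Suc k))) \<omega>"
      by (rule local_time_path.local_mono[OF local_time_path[OF \<omega>(1)]]) auto
    ultimately show "\<omega> \<in> E (Suc k)" unfolding E_def using \<omega> by (auto simp del: of_nat_Suc)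
  qed
  have upper: "?P \<le> exp (- 2 * integral {0..\<tau>} ?p)"
  proof (rule LIMSEQ_le_const2)
    show "(\<lambda>k. prob (E k)) \<longlonglongrightarrow> ?P"
      unfolding E_Union by (rule finite_Lim_measure_incseq) (use E E_inc in auto)
    have "prob (E k) \<le> exp (- 2 * integral {0..\<tau>} ?p)" for k
      unfolding E_def using assms(4) by (intro prob_reaching_le_exp) auto
    then show "\<exists>N. \<forall>k\<ge>N. prob (E k) \<le> exp (- 2 * integral {0..\<tau>} ?p)" by blast
  qed
  have approx: "exp (- 2 * (integral {0..\<tau> + 2 * e} ?p + e * (\<tau> + 2 * e))) \<le> ?P" if e: "0 < e" for e
  proof -
    let ?J = "integral {0..\<tau> + 2 * e} ?p + e * (\<tau> + 2 * e)"
    have bound: "1 \<le> exp (2 * ?J) * (?P + exp (- 2 * e\<^sup>2 * real (Suc k)))" for k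
    proof -
      have "1 \<le> exp (2 * ?J) * (prob {\<omega>\<in>space M. \<tau> + e \<le> L (real (Suc k)) \<omega>} + exp (- 2 * e\<^sup>2 * real (Suc k)))"
        using e assms(4) by (intro one_le_exp_prob_reaching) auto
      also have "\<dots> \<le> exp (2 * ?J) * (?P + exp (- 2 * e\<^sup>2 * real (Suc k)))"
      proof (intro mult_left_mono add_right_mono finite_measure_mono event subsetI)
        fix \<omega> assume "\<omega> \<in> {\<omega>\<in>space M. \<tau> + e \<le> L (real (Suc k)) \<omega>}"
        then show "\<omega> \<in> {\<omega>\<in>space M. ereal \<tau> < tau_inf (\<lambda>t. L t \<omega>)}"
          using e by (auto simp del: of_nat_Suc
              intro!: local_time_path.less_tau_inf_if_reached[OF local_time_path, of _ "real (Suc k)" _ "\<tau> + e"])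
      qed simp
      finally show ?thesis .
    qed
    have "(\<lambda>k. exp (2 * ?J) * (?P + exp (- 2 * e\<^sup>2 * real (Suc k)))) \<longlonglongrightarrow> exp (2 * ?J) * (?P + 0)"
    proof (intro tendsto_intros LIMSEQ_Suc)
      have "(\<lambda>k. exp (- 2 * e\<^sup>2) ^ k) \<longlonglongrightarrow> 0" using e by (intro LIMSEQ_power_zero) auto
      then show "(\<lambda>k. exp (- 2 * e\<^sup>2 * real k)) \<longlonglongrightarrow> 0" by (simp only: exp_of_nat2_mult)
    qed
    then have "1 \<le> exp (2 * ?J) * (?P + 0)"
      by (rule LIMSEQ_le_const) (use bound in blast)
    then have "exp (- (2 * ?J)) * 1 \<le> exp (- (2 * ?J)) * (exp (2 * ?J) * ?P)"
      by (intro mult_left_mono) auto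
    also have "\<dots> = ?P" by (simp add: mult.assoc[symmetric] exp_add[symmetric])
    finally show ?thesis by simp
  qed
  have lower: "exp (- 2 * integral {0..\<tau>} ?p) \<le> ?P"
  proof (rule LIMSEQ_le_const2)
    let ?e = "\<lambda>k. 1 / real (Suc k)"
    have e: "?e \<longlonglongrightarrow> 0" by (rule LIMSEQ_Suc[OF lim_const_over_n])
    have "continuous_on {0..\<tau> + 2} (\<lambda>t. integral {0..t} ?p)"
      by (rule indefinite_integral_continuous_1, rule pos_part_integrable) simp
    moreover have "(\<lambda>k. \<tau> + 2 * ?e k) \<longlonglongrightarrow> \<tau> + 2 * 0" by (intro tendsto_intros e)
    moreover have "\<tau> + 2 * 0 \<in> {0..\<tau> + 2}" using assms(4) by simp
    moreover have "\<forall>\<^sub>F k in sequentially. \<tau> + 2 * ?e k \<in> {0..\<tau> + 2}"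
      using assms(4) by (intro always_eventually) (auto simp: field_simps)
    ultimately have "(\<lambda>k. integral {0..\<tau> + 2 * ?e k} ?p) \<longlonglongrightarrow> integral {0..\<tau> + 2 * 0} ?p"
      by (rule continuous_on_tendsto_compose)
    then have "(\<lambda>k. exp (- 2 * (integral {0..\<tau> + 2 * ?e k} ?p + ?e k * (\<tau> + 2 * ?e k))))
        \<longlonglongrightarrow> exp (- 2 * (integral {0..\<tau> + 2 * 0} ?p + 0 * (\<tau> + 2 * 0)))"
      by (intro tendsto_exp tendsto_mult tendsto_add tendsto_const e)
    then show "(\<lambda>k. exp (- 2 * (integral {0..\<tau> + 2 * ?e k} ?p + ?e k * (\<tau> + 2 * ?e k))))
        \<longlonglongrightarrow> exp (- 2 * integral {0..\<tau>} ?p)" by simp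
    show "\<exists>N. \<forall>k\<ge>N. exp (- 2 * (integral {0..\<tau> + 2 * ?e k} ?p + ?e k * (\<tau> + 2 * ?e k))) \<le> ?P"
      by (intro exI[of _ 0] allI impI approx) simp
  qed
  have "set_integrable lborel {0..\<tau>} ?p"
    by (rule borel_integrable_atLeastAtMost', rule continuous_on_max[OF _ continuous_on_const],
        rule continuous_on_subset[OF cont_drift]) auto
  from set_borel_integral_eq_integral(2)[OF this] upper lower show ?thesis by simp
qed

end
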